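(* Let $S,S^*$ define a pair of second order PDE's as in the context (integrable, with $1-S_RS_R^*>0$), let $\theta^i$ ($i\in\{0,+,-,1\}$) be an associated tetrad with tetrad parameters $(\alpha,b,b^*,a,a^*,c)$ and conformal parameter $\Phi$, and write $d\theta^i=\tfrac12\Delta^i{}_{JK}\theta^J\wedge\theta^K$, $\Delta_{iJK}=\eta_{il}\Delta^l{}_{JK}$. Suppose there is a torsion-free generalized Weyl connection $\omega_{ij}=\omega_{ijK}\theta^K$ for this tetrad, with generalized Weyl one-form $A=A_i\theta^i+A_s\,ds+A_{s^*}\,ds^*$. Then: 1. The connection is uniquely determined by the tetrad and the components $A_i$: $$\omega_{ijs}=\Delta_{ijs},\qquad \omega_{ijs^*}=\Delta_{ijs^*},$$ $$\omega_{ijk}=\eta_{ij}A_k-\eta_{jk}A_i+\eta_{ki}A_j+\tfrac12\left(\Delta_{ijk}-\Delta_{kij}+\Delta_{jki}\right).$$ 2. The tetrad parameters are uniquely determined by $S$ and $S^*$ (with the choice of root for $b$ that vanishes when $S$ vanishes, and up to the sign of $\alpha$): $$b=\frac{-1+\sqrt{1-S_RS_R^*}}{S_R^*},\qquad \alpha^2=\frac{1+bb^*}{(1-bb^* )^2},$$ $$a=b^{-1}b^{*-1}(1-bb^* )^{-2}(1+bb^* )\left\{b^{*2}\left(-Db+bS_W-S_{W^*}\right)+b\left(-D^*b^*+b^*S^*_{W^*}-S^*_W\right)\right\}$$ (at points where $b\neq0$), and $$c=-\frac{Da+D^*a^*+T_W+T^*_{W^*}}{4}-\frac{aa^*(1+6bb^*+b^2b^{*2})}{2(1+bb^*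 )^2}+\frac{(1+bb^* )(bS^*_Z+b^*S_Z)}{2(1-bb^* )^2}+\frac{a(2ab-b^*S_{W^*})+a^*(2a^*b^*-bS^*_W)}{2(1+bb^* )}.$$ 3. $S$ and $S^*$ satisfy the (generalized) Wünschmann condition $$M\equiv\frac{Db+bD^*b+S_{W^*}-bS_W+b^2S^*_{W^*}-b^3S^*_W}{1-bb^*}=0$$ (and its complex conjugate), with $b=\dfrac{-1+\sqrt{1-S_RS_R^*}}{S_R^*}$.
   Context: Setting. $J^6$ is (an open subset of) the space with coordinates $(Z,W,W^*,R,s,s^* )$, where $Z,R$ are real, and $(W,W^* )$, $(s,s^* )$ are complex-conjugate pairs; $^*$ denotes complex conjugation, subscripts $Z,W,W^*,R,s,s^*$ on $S,S^*,T,T^*$ denote partial derivatives (e.g. $S^*_W=\partial_W(S^* )$), and all functions are smooth. A function $S$ on $J^6$ and its conjugate $S^*$ define the pair of PDE's $Z_{ss}=S(Z,Z_s,Z_{s^*},Z_{ss^*},s,s^* )$, $Z_{s^*s^*}=S^*(Z,Z_s,Z_{s^*},Z_{ss^*},s,s^* )$ for a real function $Z(s,s^* )$, with the notation $(W,W^*,R)=(Z_s,Z_{s^*},Z_{ss^*})$. Assume $1-S_RS_R^*>0$. Define $$T=\frac{S_{s^*}+W^*S_Z+RS_W+S^*S_{W^*}+S_R(S^*_s+WS^*_Z+SS^*_W+RS^*_{W^*})}{1-S_RS_R^*},$$ $T^*$ its conjugate, and the vector fields $$e_s=D=\partial_s+W\partial_Z+S\partial_W+R\partial_{W^*}+T\partial_R,\qquad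 e_{s^*}=D^*=\partial_{s^*}+W^*\partial_Z+R\partial_W+S^*\partial_{W^*}+T^*\partial_R,$$ so that $T=D^*S$, $T^*=DS^*$. Assume the integrability condition $D^2S^*=D^{*2}S$ (then $[D,D^*]=0$). Tetrad. Put $\beta^0=dZ-W\,ds-W^*ds^*$, $\beta^+=dW-S\,ds-R\,ds^*$, $\beta^-=dW^*-R\,ds-S^*ds^*$, $\beta^1=dR-T\,ds-T^*ds^*$, and $$\theta^0=\Phi\beta^0,\quad \theta^+=\Phi\alpha(\beta^++b\beta^-),\quad \theta^-=\Phi\alpha(\beta^-+b^*\beta^+),\quad \theta^1=\Phi(\beta^1+a\beta^++a^*\beta^-+c\beta^0),$$ where the "tetrad parameters" $\alpha,c$ (real), $b,a$ (complex, with conjugates $b^*,a^*$) and the "conformal parameter" $\Phi$ (real, nowhere zero) are functions on $J^6$ with $\alpha\ne0$, and $b$ on the branch vanishing when $S$ vanishes, i.e. $bb^*<1$. Together with $\theta^s=ds$, $\theta^{s^*}=ds^*$ these form a coframe of $J^6$. Lower-case indices run over $\{0,+,-,1\}$, upper-case over $\{0,+,-,1,s,s^*\}$; $\Delta^i{}_{JK}$ is skew in $JK$. $\eta_{ij}$ is the constant symmetric matrix with $\eta_{01}=\eta_{10}=1$, $\eta_{+-}=\eta_{-+}=-1$ and all other entries $0$. Where $S_R^*=0$ the expression for $b$ is read as $b=-S_R/(1+\sqrt{1-S_RS_R^*})$, i.e. $b=0$. A torsion-free generalized Weyl connection for the tetrad is a matrix of one-forms $\omega_{ij}=\omega_{ijK}\theta^K$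 on $J^6$ with $d\theta^i+\eta^{ik}\omega_{kj}\wedge\theta^j=0$ and $\omega_{ij}=\omega_{[ij]}+\eta_{ij}A$ for some one-form $A=A_i\theta^i+A_s\theta^s+A_{s^*}\theta^{s^*}$ (the generalized Weyl one-form). *)

theory Defs
  imports "HOL-Analysis.Analysis"
begin

section \<open>Smooth functions and differential forms\<close>

text \<open>On an open subset of a Euclidean space this is the usual class of k times continuously
  differentiable functions; derivatives are taken in all constant directions.\<close>

primrec Ck_on :: "nat \<Rightarrow> 'a::euclidean_space set \<Rightarrow> ('a \<Rightarrow> 'b::real_normed_vector) \<Rightarrow> bool" where
  "Ck_on 0 U f \<longleftrightarrow> continuous_on U f"
| "Ck_on (Suc k) U f \<longleftrightarrow>
     (\<forall>x\<in>U. f differentiable (at x)) \<and> (\<forall>v. Ck_on k U (\<lambda>x. frechet_derivative f (at x) v))"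

definition smooth_on :: "'a::euclidean_space set \<Rightarrow> ('a \<Rightarrow> 'b::real_normed_vector) \<Rightarrow> bool" where
  "smooth_on U f \<longleftrightarrow> (\<forall>k. Ck_on k U f)"

text \<open>Complex-valued forms: a one-form assigns to a point x and a tangent vector u a complex
  number, a two-form to x and two tangent vectors u, v. In the exterior derivative of a one-form
  u and v are constant vector fields, so that no bracket term occurs.\<close>

type_synonym 'a one_form = "'a \<Rightarrow> 'a \<Rightarrow> complex"
type_synonym 'a two_form = "'a \<Rightarrow> 'a \<Rightarrow> 'a \<Rightarrow> complex"

definition differential :: "('a::euclidean_space \<Rightarrow> complex) \<Rightarrow> 'a one_form" where
  "differential f x u = frechet_derivative f (at x) u"

definition ext_deriv :: "'a::euclidean_space one_form \<Rightarrow> 'a two_form" where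
  "ext_deriv \<theta> x u v =
     frechet_derivative (\<lambda>y. \<theta> y v) (at x) u - frechet_derivative (\<lambda>y. \<theta> y u) (at x) v"

definition wedge :: "'a one_form \<Rightarrow> 'a one_form \<Rightarrow> 'a two_form" where
  "wedge \<phi> \<psi> x u v = \<phi> x u * \<psi> x v - \<phi> x v * \<psi> x u"

section \<open>The jet space\<close>

text \<open>A point is (Z, W, R, s); the coordinates conjugate to W and s are the complex conjugates of
  these two entries.\<close>

type_synonym jet = "real \<times> complex \<times> real \<times> complex"

definition co_Z :: "jet \<Rightarrow> complex" where "co_Z x = complex_of_real (fst x)"
definition co_W :: "jet \<Rightarrow> complex" where "co_W x = fst (snd x)"
definition co_R :: "jet \<Rightarrow> complex" where "co_R x = complex_of_real (fst (snd (snd x)))"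
definition co_s :: "jet \<Rightarrow> complex" where "co_s x = snd (snd (snd x))"

definition cj :: "(jet \<Rightarrow> complex) \<Rightarrow> jet \<Rightarrow> complex" where
  "cj f x = cnj (f x)"

text \<open>Partial derivatives; those with respect to W, s and their conjugates are Wirtinger
  derivatives.\<close>

definition par_Z :: "(jet \<Rightarrow> complex) \<Rightarrow> jet \<Rightarrow> complex" where
  "par_Z f x = frechet_derivative f (at x) (1, 0, 0, 0)"
definition par_W :: "(jet \<Rightarrow> complex) \<Rightarrow> jet \<Rightarrow> complex" where
  "par_W f x = (frechet_derivative f (at x) (0, 1, 0, 0)
             - \<i> * frechet_derivative f (at x) (0, \<i>, 0, 0)) / 2"
definition par_W_conj :: "(jet \<Rightarrow> complex) \<Rightarrow> jet \<Rightarrow> complex" where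
  "par_W_conj f x = (frechet_derivative f (at x) (0, 1, 0, 0)
             + \<i> * frechet_derivative f (at x) (0, \<i>, 0, 0)) / 2"
definition par_R :: "(jet \<Rightarrow> complex) \<Rightarrow> jet \<Rightarrow> complex" where
  "par_R f x = frechet_derivative f (at x) (0, 0, 1, 0)"
definition par_s :: "(jet \<Rightarrow> complex) \<Rightarrow> jet \<Rightarrow> complex" where
  "par_s f x = (frechet_derivative f (at x) (0, 0, 0, 1)
             - \<i> * frechet_derivative f (at x) (0, 0, 0, \<i>)) / 2"
definition par_s_conj :: "(jet \<Rightarrow> complex) \<Rightarrow> jet \<Rightarrow> complex" where
  "par_s_conj f x = (frechet_derivative f (at x) (0, 0, 0, 1)
             + \<i> * frechet_derivative f (at x) (0, 0, 0, \<i>)) / 2"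

section \<open>The pair of equations\<close>

definition T :: "(jet \<Rightarrow> complex) \<Rightarrow> jet \<Rightarrow> complex" where
  "T S x = (par_s_conj S x + cnj (co_W x) * par_Z S x + co_R x * par_W S x + cj S x * par_W_conj S x
            + par_R S x * (par_s (cj S) x + co_W x * par_Z (cj S) x + S x * par_W (cj S) x
                        + co_R x * par_W_conj (cj S) x))
           / (1 - par_R S x * par_R (cj S) x)"

text \<open>The vector fields D and its conjugate, acting on functions.\<close>

definition D :: "(jet \<Rightarrow> complex) \<Rightarrow> (jet \<Rightarrow> complex) \<Rightarrow> jet \<Rightarrow> complex" where
  "D S f x = par_s f x + co_W x * par_Z f x + S x * par_W f x + co_R x * par_W_conj f x + T S x * par_R f x"

definition D_conj :: "(jet \<Rightarrow> complex) \<Rightarrow> (jet \<Rightarrow> complex) \<Rightarrow> jet \<Rightarrow> complex" where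
  "D_conj S f x = par_s_conj f x + cnj (co_W x) * par_Z f x + co_R x * par_W f x + cj S x * par_W_conj f x
                  + cj (T S) x * par_R f x"

text \<open>The product of the R-derivatives of S and of its conjugate is real.\<close>

definition integrable_pde_pair :: "jet set \<Rightarrow> (jet \<Rightarrow> complex) \<Rightarrow> bool" where
  "integrable_pde_pair U S \<longleftrightarrow>
     open U \<and> smooth_on U S \<and>
     (\<forall>x\<in>U. 0 < Re (1 - par_R S x * par_R (cj S) x)) \<and>
     (\<forall>x\<in>U. D S (D S (cj S)) x = D_conj S (D_conj S S) x)"

section \<open>The tetrad\<close>

text \<open>The index values 0, +, -, 1 (lower-case indices); upper-case indices have in addition the
  values s and its conjugate.\<close>

datatype idx = I0 | Ip | Im | I1
datatype full_idx = L idx | Is | Is_conj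

lemma UNIV_idx: "UNIV = {I0, Ip, Im, I1}"
  using idx.exhaust by blast

lemma UNIV_full_idx: "UNIV = {L I0, L Ip, L Im, L I1, Is, Is_conj}"
proof -
  have "x \<in> {L I0, L Ip, L Im, L I1, Is, Is_conj}" for x
  proof (cases x)
    case (L i)
    then show ?thesis by (cases i) simp_all
  qed simp_all
  then show ?thesis by blast
qed

instance idx :: finite
  by standard (simp add: UNIV_idx)

instance full_idx :: finite
  by standard (simp add: UNIV_full_idx)

fun eta :: "idx \<Rightarrow> idx \<Rightarrow> complex" where
  "eta I0 I1 = 1"
| "eta I1 I0 = 1"
| "eta Ip Im = -1"
| "eta Im Ip = -1"
| "eta _ _ = 0"

text \<open>The matrix is its own inverse, so eta also serves as the matrix with upper indices.\<close>

lemma eta_inverse: "(\<Sum>k\<in>UNIV. eta i k * eta k j) = (if i = j then 1 else 0)"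
  by (cases i; cases j; simp add: UNIV_idx)

definition beta0 :: "jet one_form" where
  "beta0 x u = differential co_Z x u - co_W x * differential co_s x u
               - cnj (co_W x) * differential (cj co_s) x u"

definition beta_plus :: "(jet \<Rightarrow> complex) \<Rightarrow> jet one_form" where
  "beta_plus S x u = differential co_W x u - S x * differential co_s x u
                     - co_R x * differential (cj co_s) x u"

definition beta_minus :: "(jet \<Rightarrow> complex) \<Rightarrow> jet one_form" where
  "beta_minus S x u = differential (cj co_W) x u - co_R x * differential co_s x u
                      - cj S x * differential (cj co_s) x u"

definition beta1 :: "(jet \<Rightarrow> complex) \<Rightarrow> jet one_form" where
  "beta1 S x u = differential co_R x u - T S x * differential co_s x u
                 - cj (T S) x * differential (cj co_s) x u"

text \<open>The real parameters are real-valued functions; the others are complex, with conjugates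
  obtained by complex conjugation.\<close>

record tetrad_data =
  Phi_of :: "jet \<Rightarrow> real"
  alpha_of :: "jet \<Rightarrow> real"
  b_of :: "jet \<Rightarrow> complex"
  a_of :: "jet \<Rightarrow> complex"
  c_of :: "jet \<Rightarrow> real"

definition tetrad_params :: "jet set \<Rightarrow> tetrad_data \<Rightarrow> bool" where
  "tetrad_params U p \<longleftrightarrow>
     smooth_on U (Phi_of p) \<and> smooth_on U (alpha_of p) \<and> smooth_on U (b_of p) \<and>
     smooth_on U (a_of p) \<and> smooth_on U (c_of p) \<and>
     (\<forall>x\<in>U. Phi_of p x \<noteq> 0 \<and> alpha_of p x \<noteq> 0 \<and> Re (b_of p x * cnj (b_of p x)) < 1)"

fun coframe :: "(jet \<Rightarrow> complex) \<Rightarrow> tetrad_data \<Rightarrow> full_idx \<Rightarrow> jet one_form" where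
  "coframe S p (L I0) = (\<lambda>x u. complex_of_real (Phi_of p x) * beta0 x u)"
| "coframe S p (L Ip) = (\<lambda>x u. complex_of_real (Phi_of p x) * complex_of_real (alpha_of p x)
                           * (beta_plus S x u + b_of p x * beta_minus S x u))"
| "coframe S p (L Im) = (\<lambda>x u. complex_of_real (Phi_of p x) * complex_of_real (alpha_of p x)
                           * (beta_minus S x u + cnj (b_of p x) * beta_plus S x u))"
| "coframe S p (L I1) = (\<lambda>x u. complex_of_real (Phi_of p x)
                           * (beta1 S x u + a_of p x * beta_plus S x u
                              + cnj (a_of p x) * beta_minus S x u
                              + complex_of_real (c_of p x) * beta0 x u))"
| "coframe S p Is = differential co_s"
| "coframe S p Is_conj = differential (cj co_s)"

type_synonym components = "idx \<Rightarrow> full_idx \<Rightarrow> full_idx \<Rightarrow> jet \<Rightarrow> complex"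

text \<open>The structure functions of the tetrad, with the first index raised.\<close>

definition structure_functions ::
    "jet set \<Rightarrow> (jet \<Rightarrow> complex) \<Rightarrow> tetrad_data \<Rightarrow> components \<Rightarrow> bool" where
  "structure_functions U S p \<Delta> \<longleftrightarrow>
     (\<forall>i J K. \<forall>x\<in>U. \<Delta> i J K x = - \<Delta> i K J x) \<and>
     (\<forall>i. \<forall>x\<in>U. \<forall>u v. ext_deriv (coframe S p (L i)) x u v =
        1 / 2 * (\<Sum>J\<in>UNIV. \<Sum>K\<in>UNIV. \<Delta> i J K x * wedge (coframe S p J) (coframe S p K) x u v))"

definition lowered :: "components \<Rightarrow> components" where
  "lowered \<Delta> i J K x = (\<Sum>l\<in>UNIV. eta i l * \<Delta> l J K x)"

section \<open>Torsion-free generalized Weyl connections\<close>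

definition form_of :: "(jet \<Rightarrow> complex) \<Rightarrow> tetrad_data \<Rightarrow> (full_idx \<Rightarrow> jet \<Rightarrow> complex) \<Rightarrow> jet one_form" where
  "form_of S p w x u = (\<Sum>K\<in>UNIV. w K x * coframe S p K x u)"

text \<open>The connection and the Weyl one-form are given by their components with respect to the
  coframe; both indices of the connection are lowered. The conditions are smoothness, vanishing
  torsion, and that the symmetric part of the connection is the Weyl one-form times eta.\<close>

definition torsion_free_weyl_connection ::
    "jet set \<Rightarrow> (jet \<Rightarrow> complex) \<Rightarrow> tetrad_data \<Rightarrow> (idx \<Rightarrow> idx \<Rightarrow> full_idx \<Rightarrow> jet \<Rightarrow> complex)
     \<Rightarrow> (full_idx \<Rightarrow> jet \<Rightarrow> complex) \<Rightarrow> bool" where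
  "torsion_free_weyl_connection U S p \<omega> A \<longleftrightarrow>
     (\<forall>i j K. smooth_on U (\<omega> i j K)) \<and> (\<forall>K. smooth_on U (A K)) \<and>
     (\<forall>i. \<forall>x\<in>U. \<forall>u v.
        ext_deriv (coframe S p (L i)) x u v
        + (\<Sum>k\<in>UNIV. \<Sum>j\<in>UNIV. eta i k * wedge (form_of S p (\<omega> k j)) (coframe S p (L j)) x u v)
        = 0) \<and>
     (\<forall>i j. \<forall>x\<in>U. \<forall>u.
        form_of S p (\<omega> i j) x u =
          (form_of S p (\<omega> i j) x u - form_of S p (\<omega> j i) x u) / 2 + eta i j * form_of S p A x u)"

section \<open>The root b and the Wuenschmann function\<close>

text \<open>The first case is the value of the equivalent form
  - S_R / (1 + sqrt (1 - S_R S_R*)), which has no singularity.\<close>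

definition b_root :: "(jet \<Rightarrow> complex) \<Rightarrow> jet \<Rightarrow> complex" where
  "b_root S x =
     (if par_R (cj S) x = 0 then 0
      else (-1 + csqrt (1 - par_R S x * par_R (cj S) x)) / par_R (cj S) x)"

definition wuenschmann :: "(jet \<Rightarrow> complex) \<Rightarrow> jet \<Rightarrow> complex" where
  "wuenschmann S x =
     (let B = b_root S in
      (D S B x + B x * D_conj S B x + par_W_conj S x - B x * par_W S x
        + (B x)^2 * par_W_conj (cj S) x - (B x)^3 * par_W (cj S) x)
      / (1 - B x * cnj (B x)))"

end

theory Submission
  imports Defs
begin

text \<open>The contraction of the torsion equation with D and with the metric, evaluated on a complex
  vector X with vanishing ds-components, kills the skew part of the connection. What remains says
  that the Lie derivative along D of the quadratic form
  \<open>\<beta>\<^sup>0(\<beta>\<^sup>1 + a\<beta>\<^sup>+ + a\<^sup>*\<beta>\<^sup>- + c\<beta>\<^sup>0) - \<alpha>\<^sup>2(\<beta>\<^sup>+ + b\<beta>\<^sup>-)(\<beta>\<^sup>- + b\<^sup>*\<beta>\<^sup>+)\<close> is a multiple, by an unknown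
  factor lam, of this form. Comparing coefficients gives equations for the parameters;
  together with their complex conjugates they are solved pointwise. The coefficients without lam give
  b and \<open>\<alpha>\<close>. Eliminating lam in two ways expresses a once through D and once through its
  conjugate; with M the Wuenschmann function, the two expressions agree iff b times the conjugate of
  M is the square of the conjugate of b times M, and since |b| < 1 this forces M = 0.\<close>

section \<open>Derivatives on the jet space\<close>

lemma smooth_on_differentiable: "smooth_on U f \<Longrightarrow> x \<in> U \<Longrightarrow> f differentiable (at x)"
  unfolding smooth_on_def by (metis Ck_on.simps(2))

lemma smooth_on_frechet_differentiable:
  "smooth_on U f \<Longrightarrow> x \<in> U \<Longrightarrow> (\<lambda>y. frechet_derivative f (at y) v) differentiable (at x)"
  unfolding smooth_on_def by (metis Ck_on.simps(2))

lemma differentiable_cong_open: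
  assumes "open U" "x \<in> U" "\<And>y. y \<in> U \<Longrightarrow> f y = g y" "g differentiable (at x)"
  shows "f differentiable (at x)"
proof -
  obtain g' where "(g has_derivative g') (at x)" using assms(4) by (auto simp: differentiable_def)
  then have "(f has_derivative g') (at x)"
    using has_derivative_transform_within_open[of g g' x UNIV U f] assms by auto
  then show ?thesis by (auto simp: differentiable_def)
qed

text \<open>\<open>frechet_derivative\<close> is a choice among the maps satisfying
  \<open>has_derivative\<close>, so functions that agree near x give the same choice, whether or not
  they are differentiable.\<close>

lemma frechet_derivative_cong_open:
  assumes "open U" "x \<in> U" "\<And>y. y \<in> U \<Longrightarrow> f y = g y"
  shows "frechet_derivative f (at x) = frechet_derivative g (at x)"
proof -
  have "(f has_derivative h) (at x) = (g has_derivative h) (at x)" for h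
    using has_derivative_transform_within_open[of g h x UNIV U f]
      has_derivative_transform_within_open[of f h x UNIV U g] assms by auto
  then show ?thesis by (simp add: frechet_derivative_def)
qed

lemma frechet_derivative_unique: "(f has_derivative f') (at x) \<Longrightarrow> frechet_derivative f (at x) = f'"
  by (simp add: frechet_derivative_at[symmetric])

section \<open>Complex conjugation of functions and of their derivatives\<close>

lemma frechet_derivative_cj:
  assumes "f differentiable (at x)"
  shows "frechet_derivative (cj f) (at x) u = cnj (frechet_derivative f (at x) u)"
proof -
  have "(cj f has_derivative (\<lambda>u. cnj (frechet_derivative f (at x) u))) (at x)"
    using bounded_linear.has_derivative[OF bounded_linear_cnj]
      assms[unfolded frechet_derivative_works] unfolding cj_def by blast
  then show ?thesis using frechet_derivative_at by metis
qed

lemma differentiable_cj: "f differentiable (at x) \<Longrightarrow> cj f differentiable (at x)"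
  unfolding differentiable_def cj_def
  using bounded_linear.has_derivative[OF bounded_linear_cnj] by blast

lemma differentiable_of_real:
  "f differentiable (at x) \<Longrightarrow> (\<lambda>y. complex_of_real (f y)) differentiable (at x)"
  unfolding differentiable_def
  using bounded_linear.has_derivative[OF bounded_linear_of_real] by blast

text \<open>Real directional derivatives commute with conjugation, while the factor i in the
  Wirtinger combinations changes sign; hence the two directions of each conjugate pair are
  exchanged.\<close>

lemma par_cj:
  assumes "f differentiable (at x)"
  shows "par_Z (cj f) x = cnj (par_Z f x)" "par_W (cj f) x = cnj (par_W_conj f x)"
    "par_W_conj (cj f) x = cnj (par_W f x)" "par_R (cj f) x = cnj (par_R f x)"
    "par_s (cj f) x = cnj (par_s_conj f x)" "par_s_conj (cj f) x = cnj (par_s f x)"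
  using frechet_derivative_cj[OF assms]
  by (simp_all add: par_Z_def par_W_def par_W_conj_def par_R_def par_s_def par_s_conj_def)

text \<open>The coefficients of \<open>D_conj\<close> are the conjugates of those of
  \<open>D\<close>, the coordinate R being real. Hence equations need only be derived along
  \<open>D\<close> and then conjugated.\<close>

lemma D_conj_cj:
  assumes "f differentiable (at x)"
  shows "D_conj S (cj f) x = cnj (D S f x)"
  using par_cj[OF assms] by (simp add: D_def D_conj_def cj_def co_R_def)

lemma cj_cj [simp]: "cj (cj f) = f"
  by (simp add: cj_def fun_eq_iff)

section \<open>The coordinates as linear maps, and differentiability of T\<close>

lemma bounded_linear_co:
  "bounded_linear co_Z" "bounded_linear co_W" "bounded_linear co_R" "bounded_linear co_s"
  unfolding co_Z_def[abs_def] co_W_def[abs_def] co_R_def[abs_def] co_s_def[abs_def]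
  by (intro bounded_linear_compose[OF bounded_linear_of_real]
      bounded_linear_compose[OF bounded_linear_fst] bounded_linear_compose[OF bounded_linear_snd]
      bounded_linear_fst bounded_linear_snd)+

lemma differentiable_co [simp]:
  "co_Z differentiable (at x)" "co_W differentiable (at x)"
  "co_R differentiable (at x)" "co_s differentiable (at x)"
  using bounded_linear_co bounded_linear_imp_differentiable by blast+

lemma differential_co:
  "differential co_Z x = co_Z" "differential co_W x = co_W"
  "differential co_R x = co_R" "differential co_s x = co_s"
  "differential (cj co_W) x = cj co_W" "differential (cj co_s) x = cj co_s"
  using bounded_linear_co[THEN bounded_linear_imp_has_derivative, THEN frechet_derivative_unique]
  by (simp_all add: differential_def fun_eq_iff frechet_derivative_cj, simp_all add: cj_def)

lemma par_differentiable:
  assumes "smooth_on U f" "x \<in> U"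
  shows "par_Z f differentiable (at x)" "par_W f differentiable (at x)"
    "par_W_conj f differentiable (at x)" "par_R f differentiable (at x)"
    "par_s f differentiable (at x)" "par_s_conj f differentiable (at x)"
  unfolding par_Z_def[abs_def] par_W_def[abs_def] par_W_conj_def[abs_def] par_R_def[abs_def]
    par_s_def[abs_def] par_s_conj_def[abs_def] divide_inverse
  by (intro derivative_intros smooth_on_frechet_differentiable[OF assms])+

lemma par_cj_differentiable:
  assumes "open U" "smooth_on U f" "x \<in> U"
  shows "par_Z (cj f) differentiable (at x)" "par_W (cj f) differentiable (at x)"
    "par_W_conj (cj f) differentiable (at x)" "par_R (cj f) differentiable (at x)"
    "par_s (cj f) differentiable (at x)" "par_s_conj (cj f) differentiable (at x)"
proof -
  have *: "g differentiable (at x)"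
    if "h differentiable (at x)" "\<And>y. y \<in> U \<Longrightarrow> g y = cnj (h y)" for g h
    using differentiable_cong_open[OF assms(1,3), of g "cj h"] that differentiable_cj
    by (simp add: cj_def)
  show "par_Z (cj f) differentiable (at x)" "par_W (cj f) differentiable (at x)"
    "par_W_conj (cj f) differentiable (at x)" "par_R (cj f) differentiable (at x)"
    "par_s (cj f) differentiable (at x)" "par_s_conj (cj f) differentiable (at x)"
    using par_differentiable[OF assms(2,3)] par_cj[OF smooth_on_differentiable[OF assms(2)]]
    by (auto intro: *)
qed

lemma T_differentiable:
  assumes "integrable_pde_pair U S" "x \<in> U"
  shows "T S differentiable (at x)"
proof -
  have U: "open U" "smooth_on U S" and "0 < Re (1 - par_R S x * par_R (cj S) x)"
    using assms unfolding integrable_pde_pair_def by auto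
  then have nz: "1 - par_R S x * par_R (cj S) x \<noteq> 0" by (metis less_irrefl zero_complex.sel(1))
  have c: "(\<lambda>x. cnj (co_W x)) differentiable (at x)"
    using differentiable_cj[of co_W x] by (simp add: cj_def[abs_def])
  have S: "S differentiable (at x)" using U assms smooth_on_differentiable by blast
  show ?thesis
    unfolding T_def[abs_def]
    by (intro derivative_intros par_differentiable[OF U(2) assms(2)] S c nz differentiable_cj
        par_cj_differentiable[OF U assms(2)] differentiable_co)
qed

section \<open>Complexified tangent vectors\<close>

text \<open>A pair (u, v) of real tangent vectors stands for the complex vector u + i v.\<close>

definition cext :: "(jet \<Rightarrow> complex) \<Rightarrow> jet \<times> jet \<Rightarrow> complex" where
  "cext \<phi> E = \<phi> (fst E) + \<i> * \<phi> (snd E)"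

definition cext2 :: "(jet \<Rightarrow> jet \<Rightarrow> complex) \<Rightarrow> jet \<times> jet \<Rightarrow> jet \<times> jet \<Rightarrow> complex" where
  "cext2 \<Omega> E F = cext (\<lambda>u. cext (\<Omega> u) F) E"

text \<open>The vector with complexified coordinates (Z, W, W*, R, s, s*) = (z, w, w', r, s, s'), where the
  entries of a conjugate pair are independent.\<close>

definition cvec :: "complex \<Rightarrow> complex \<Rightarrow> complex \<Rightarrow> complex \<Rightarrow> complex \<Rightarrow> complex \<Rightarrow> jet \<times> jet" where
  "cvec z w w' r s s' =
     ((Re z, (w + cnj w') / 2, Re r, (s + cnj s') / 2),
      (Complex.Im z, (w - cnj w') / (2 * \<i>), Complex.Im r, (s - cnj s') / (2 * \<i>)))"

lemma linear_jet:
  fixes \<phi> :: "jet \<Rightarrow> complex"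
  assumes "linear \<phi>"
  shows "\<phi> (z, w, r, s) = z * \<phi> (1, 0, 0, 0) + Re w * \<phi> (0, 1, 0, 0) + Complex.Im w * \<phi> (0, \<i>, 0, 0)
    + r * \<phi> (0, 0, 1, 0) + Re s * \<phi> (0, 0, 0, 1) + Complex.Im s * \<phi> (0, 0, 0, \<i>)"
proof -
  have "(z, w, r, s) = z *\<^sub>R (1, 0, 0, 0) + Re w *\<^sub>R (0, 1, 0, 0) + Complex.Im w *\<^sub>R (0, \<i>, 0, 0)
    + r *\<^sub>R (0, 0, 1, 0) + Re s *\<^sub>R (0, 0, 0, 1) + Complex.Im s *\<^sub>R (0, 0, 0, \<i>)"
    by (simp add: complex_eq_iff)
  then have "\<phi> (z, w, r, s) = \<phi> \<dots>" by (rule arg_cong)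
  also have "\<dots> = z *\<^sub>R \<phi> (1, 0, 0, 0) + Re w *\<^sub>R \<phi> (0, 1, 0, 0) + Complex.Im w *\<^sub>R \<phi> (0, \<i>, 0, 0)
    + r *\<^sub>R \<phi> (0, 0, 1, 0) + Re s *\<^sub>R \<phi> (0, 0, 0, 1) + Complex.Im s *\<^sub>R \<phi> (0, 0, 0, \<i>)"
    by (simp only: linear_add[OF assms] linear_scale[OF assms])
  finally show ?thesis by (simp add: scaleR_conv_of_real)
qed

text \<open>When a real-linear form is expanded on the six real basis vectors, the coefficients of w
  and w' become the two Wirtinger combinations, so w and w' act as independent components.\<close>

lemma cext_cvec:
  assumes "linear \<phi>"
  shows "cext \<phi> (cvec z w w' r s s') =
    z * \<phi> (1, 0, 0, 0) + w * ((\<phi> (0, 1, 0, 0) - \<i> * \<phi> (0, \<i>, 0, 0)) / 2)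
    + w' * ((\<phi> (0, 1, 0, 0) + \<i> * \<phi> (0, \<i>, 0, 0)) / 2) + r * \<phi> (0, 0, 1, 0)
    + s * ((\<phi> (0, 0, 0, 1) - \<i> * \<phi> (0, 0, 0, \<i>)) / 2)
    + s' * ((\<phi> (0, 0, 0, 1) + \<i> * \<phi> (0, 0, 0, \<i>)) / 2)"
  unfolding cext_def cvec_def
  by (simp add: linear_jet[OF assms, of "Re z"] linear_jet[OF assms, of "Complex.Im z"])
    (simp add: complex_eq_iff field_simps)

lemma cext_differential:
  assumes "f differentiable (at x)"
  shows "cext (differential f x) (cvec z w w' r s s') =
    z * par_Z f x + w * par_W f x + w' * par_W_conj f x + r * par_R f x
    + s * par_s f x + s' * par_s_conj f x"
  using cext_cvec[OF linear_frechet_derivative[OF assms]]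
  by (simp add: differential_def[abs_def] par_Z_def par_W_def par_W_conj_def par_R_def
      par_s_def par_s_conj_def)

text \<open>The entries of \<open>cvec\<close> solve W(u) + i W(v) = w and cnj W(u) + i cnj W(v) =
  w' for the real vectors u and v, and likewise for s.\<close>

lemma cext_co:
  "cext co_Z (cvec z w w' r s s') = z" "cext co_W (cvec z w w' r s s') = w"
  "cext co_R (cvec z w w' r s s') = r" "cext co_s (cvec z w w' r s s') = s"
  "cext (cj co_W) (cvec z w w' r s s') = w'" "cext (cj co_s) (cvec z w w' r s s') = s'"
  by (simp_all add: cext_def cvec_def co_Z_def co_W_def co_R_def co_s_def cj_def
      complex_eq_iff field_simps)

lemma cext_sum: "cext (\<lambda>u. \<Sum>i\<in>I. c i * f i u) E = (\<Sum>i\<in>I. c i * cext (f i) E)"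
  by (simp add: cext_def sum.distrib[symmetric] sum_distrib_left algebra_simps)

lemma cext_add: "cext (\<lambda>u. f u + g u) E = cext f E + cext g E"
  and cext_diff: "cext (\<lambda>u. f u - g u) E = cext f E - cext g E"
  and cext_cmult: "cext (\<lambda>u. c * f u) E = c * cext f E"
  and cext_multc: "cext (\<lambda>u. f u * c) E = cext f E * c"
  by (simp_all add: cext_def algebra_simps)

lemma cext2_wedge:
  "cext2 (wedge \<phi> \<psi> x) E F = cext (\<phi> x) E * cext (\<psi> x) F - cext (\<phi> x) F * cext (\<psi> x) E"
  by (simp add: cext2_def cext_def wedge_def algebra_simps)

lemma cext2_sum: "cext2 (\<lambda>u v. \<Sum>i\<in>I. c i * \<Omega> i u v) E F = (\<Sum>i\<in>I. c i * cext2 (\<Omega> i) E F)"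
  by (simp add: cext2_def cext_sum)

lemma cext2_add: "cext2 (\<lambda>u v. \<Omega> u v + \<Omega>' u v) E F = cext2 \<Omega> E F + cext2 \<Omega>' E F"
  and cext2_cmult: "cext2 (\<lambda>u v. c * \<Omega> u v) E F = c * cext2 \<Omega> E F"
  by (simp_all add: cext2_def cext_add cext_cmult)

lemma cext2_sum': "cext2 (\<lambda>u v. \<Sum>i\<in>I. \<Omega> i u v) E F = (\<Sum>i\<in>I. cext2 (\<Omega> i) E F)"
  using cext2_sum[of "\<lambda>_. 1" \<Omega> I] by simp

section \<open>The exterior derivative of a contact form\<close>

lemma differential_works:
  "f differentiable (at x) \<Longrightarrow> (f has_derivative differential f x) (at x)"
  by (simp add: differential_def[abs_def] frechet_derivative_works)

lemma differential_mult:
  assumes "f differentiable (at x)" "g differentiable (at x)"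
  shows "differential (\<lambda>y. f y * g y) x = (\<lambda>u. f x * differential g x u + differential f x u * g x)"
  using frechet_derivative_unique[OF has_derivative_mult[OF assms[THEN differential_works]]]
  by (simp add: differential_def[abs_def])

lemma differential_add:
  assumes "f differentiable (at x)" "g differentiable (at x)"
  shows "differential (\<lambda>y. f y + g y) x = (\<lambda>u. differential f x u + differential g x u)"
  using frechet_derivative_unique[OF has_derivative_add[OF assms[THEN differential_works]]]
  by (simp add: differential_def[abs_def])

lemma differential_const: "differential (\<lambda>y. c) x = (\<lambda>u. 0)"
  using frechet_derivative_unique[OF has_derivative_const]
  by (simp add: differential_def[abs_def])

text \<open>The derivation \<open>D\<close> becomes df on a complex tangent vector: it inherits the
  rules of the differential, and the vector can be inserted into two-forms.\<close>

lemma D_eq_cext: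
  assumes "f differentiable (at x)"
  shows "D S f x = cext (differential f x) (cvec (co_W x) (S x) (co_R x) (T S x) 1 0)"
  by (simp add: D_def cext_differential[OF assms])

lemma D_mult:
  assumes "f differentiable (at x)" "g differentiable (at x)"
  shows "D S (\<lambda>y. f y * g y) x = f x * D S g x + D S f x * g x"
  using assms
  by (simp add: D_eq_cext differentiable_mult differential_mult cext_add cext_cmult cext_multc)

lemma D_add:
  assumes "f differentiable (at x)" "g differentiable (at x)"
  shows "D S (\<lambda>y. f y + g y) x = D S f x + D S g x"
  using assms
  by (simp add: D_eq_cext differentiable_add differential_add cext_add)

lemma D_const: "D S (\<lambda>y. c) x = 0"
  by (simp add: D_eq_cext differential_const cext_def)

lemma D_cong:
  assumes "open U" "x \<in> U" "\<And>y. y \<in> U \<Longrightarrow> f y = g y"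
  shows "D S f x = D S g x"
  using frechet_derivative_cong_open[OF assms]
  by (simp add: D_def par_Z_def par_W_def par_W_conj_def par_R_def par_s_def par_s_conj_def)

text \<open>The forms \<open>l i\<close> do not depend on the point, so only the coefficients are
  differentiated: d(f l) is the wedge of df and l.\<close>

lemma ext_deriv_coordinates:
  fixes f :: "'i \<Rightarrow> jet \<Rightarrow> complex" and l :: "'i \<Rightarrow> jet \<Rightarrow> complex"
  assumes "finite I" "\<And>i. i \<in> I \<Longrightarrow> f i differentiable (at x)"
    "\<And>y u. \<theta> y u = (\<Sum>i\<in>I. f i y * l i u)"
  shows "ext_deriv \<theta> x u v = (\<Sum>i\<in>I. wedge (differential (f i)) (\<lambda>_. l i) x u v)"
proof -
  have der: "((\<lambda>y. \<theta> y v) has_derivative (\<lambda>u. \<Sum>i\<in>I. differential (f i) x u * l i v)) (at x)" for v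
    unfolding assms(3)
    by (intro has_derivative_sum has_derivative_mult_left differential_works assms(2))
  then have *: "frechet_derivative (\<lambda>y. \<theta> y v) (at x) u = (\<Sum>i\<in>I. differential (f i) x u * l i v)" for u v
    by (simp add: frechet_derivative_unique[OF der])
  show ?thesis by (simp add: ext_deriv_def * wedge_def sum_subtractf)
qed

text \<open>The index type only labels the six coordinates here. They are linear, so each is its own
  differential and also serves as a constant one-form.\<close>

fun coord :: "full_idx \<Rightarrow> jet \<Rightarrow> complex" where
  "coord (L I0) = co_Z"
| "coord (L Ip) = co_W"
| "coord (L Im) = cj co_W"
| "coord (L I1) = co_R"
| "coord Is = co_s"
| "coord Is_conj = cj co_s"

text \<open>Only the ds-coefficients (co_W, S, co_R, T) of the contact forms contribute, since the last
  two arguments have no component along the conjugate of ds.\<close>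

lemma ext_deriv_contact:
  assumes diff: "f0 differentiable (at x)" "fp differentiable (at x)" "fm differentiable (at x)"
      "f1 differentiable (at x)" "S differentiable (at x)" "T S differentiable (at x)"
    and \<theta>: "\<And>y u. \<theta> y u = f0 y * beta0 y u + fp y * beta_plus S y u
              + fm y * beta_minus S y u + f1 y * beta1 S y u"
  shows "cext2 (ext_deriv \<theta> x) (cvec z w w' r 0 0) (cvec (co_W x) (S x) (co_R x) (T S x) 1 0) =
    - (D S f0 x * z + D S fp x * w + D S fm x * w' + D S f1 x * r + f0 x * w
       + fp x * (z * par_Z S x + w * par_W S x + w' * par_W_conj S x + r * par_R S x)
       + fm x * r
       + f1 x * (z * par_Z (T S) x + w * par_W (T S) x + w' * par_W_conj (T S) x + r * par_R (T S) x))"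
    (is "cext2 _ ?X ?D = _")
proof -
  \<comment> \<open>These are the coefficients of \<open>\<theta>\<close> over the coordinate
    differentials. The factor \<open>- 1\<close> leaves only sums and products, to which the rules
    for \<open>differential\<close> apply.\<close>
  define f where "f J = (case J of L i \<Rightarrow> (case i of I0 \<Rightarrow> f0 | Ip \<Rightarrow> fp | Im \<Rightarrow> fm | I1 \<Rightarrow> f1)
    | Is \<Rightarrow> (\<lambda>y. - 1 * (f0 y * co_W y + (fp y * S y + (fm y * co_R y + f1 y * T S y))))
    | Is_conj \<Rightarrow> (\<lambda>y. - 1 * (f0 y * cj co_W y + (fp y * co_R y + (fm y * cj S y + f1 y * cj (T S) y)))))" for J
  have fd: "f J differentiable (at x)" for J
    using diff differentiable_cj[OF diff(5)] differentiable_cj[OF diff(6)]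
      differentiable_cj[OF differentiable_co(2), of x]
    by (cases J; (cases "case J of L i \<Rightarrow> i | _ \<Rightarrow> I0")?)
      (auto simp: f_def intro!: derivative_intros)
  have \<theta>_coord: "\<theta> y u = (\<Sum>J\<in>UNIV. f J y * coord J u)" for y u
    unfolding \<theta> beta0_def beta_plus_def beta_minus_def beta1_def differential_co
    by (simp add: UNIV_full_idx f_def cj_def algebra_simps)
  have "ext_deriv \<theta> x = (\<lambda>u v. \<Sum>J\<in>UNIV. 1 * wedge (differential (f J)) (\<lambda>_. coord J) x u v)"
    by (intro ext) (simp add: ext_deriv_coordinates[OF finite fd \<theta>_coord])
  then have "cext2 (ext_deriv \<theta> x) E F
      = (\<Sum>J\<in>UNIV. 1 * cext2 (wedge (differential (f J)) (\<lambda>_. coord J) x) E F)" for E F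
    by (simp only: cext2_sum)
  then have *: "cext2 (ext_deriv \<theta> x) ?X ?D = (\<Sum>J\<in>UNIV. cext (differential (f J) x) ?X * cext (coord J) ?D
      - cext (differential (f J) x) ?D * cext (coord J) ?X)"
    by (simp add: cext2_wedge)
  \<comment> \<open>The derivatives of f0, fp, fm, f1 along \<open>?X\<close> occurring here cancel
    against the summands \<open>L i\<close>, because the contact forms vanish on
    \<open>?D\<close>.\<close>
  have "cext (differential (f Is) x) ?X = - (cext (differential f0 x) ?X * co_W x + f0 x * w
      + cext (differential fp x) ?X * S x + fp x * cext (differential S x) ?X
      + cext (differential fm x) ?X * co_R x + fm x * r
      + cext (differential f1 x) ?X * T S x + f1 x * cext (differential (T S) x) ?X)"
    by (simp only: f_def full_idx.case differential_mult differential_add differential_const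
        cext_add cext_cmult cext_multc differential_co cext_co diff differentiable_mult
        differentiable_add differentiable_const differentiable_co)
      (simp add: cext_def)
  then show ?thesis
    unfolding * UNIV_full_idx
    by (simp add: cext_co diff D_eq_cext[symmetric] f_def)
      (simp add: cext_differential diff algebra_simps)
qed

lemma cext_beta:
  "cext (beta0 x) (cvec z w w' r s s') = z - co_W x * s - cnj (co_W x) * s'"
  "cext (beta_plus S x) (cvec z w w' r s s') = w - S x * s - co_R x * s'"
  "cext (beta_minus S x) (cvec z w w' r s s') = w' - co_R x * s - cj S x * s'"
  "cext (beta1 S x) (cvec z w w' r s s') = r - T S x * s - cj (T S) x * s'"
  unfolding beta0_def[abs_def] beta_plus_def[abs_def] beta_minus_def[abs_def] beta1_def[abs_def]
    differential_co
  by (simp_all add: cext_diff cext_cmult cext_co)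

section \<open>The dual frame\<close>

definition Dvec :: "(jet \<Rightarrow> complex) \<Rightarrow> jet \<Rightarrow> jet \<times> jet" where
  "Dvec S x = cvec (co_W x) (S x) (co_R x) (T S x) 1 0"

text \<open>This inverts the coframe on vectors without ds-components: the forms with indices + and
  - give a 2x2 system whose determinant is 1 - b cnj b up to scale, and the form with index 1 then
  fixes the R-component.\<close>

definition lowvec :: "tetrad_data \<Rightarrow> jet \<Rightarrow> (idx \<Rightarrow> complex) \<Rightarrow> jet \<times> jet" where
  "lowvec p x t =
    (let F = complex_of_real (Phi_of p x); b = b_of p x; a = a_of p x;
         N = F * complex_of_real (alpha_of p x) * (1 - b * cnj b);
         z = t I0 / F; w = (t Ip - b * t Im) / N; w' = (t Im - cnj b * t Ip) / N
     in cvec z w w' (t I1 / F - a * w - cnj a * w' - complex_of_real (c_of p x) * z) 0 0)"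

fun frame :: "(jet \<Rightarrow> complex) \<Rightarrow> tetrad_data \<Rightarrow> jet \<Rightarrow> full_idx \<Rightarrow> jet \<times> jet" where
  "frame S p x (L j) = lowvec p x (\<lambda>i. if i = j then 1 else 0)"
| "frame S p x Is = Dvec S x"
| "frame S p x Is_conj = cvec (cnj (co_W x)) (co_R x) (cj S x) (cj (T S) x) 0 1"

lemma one_minus_bb_nonzero:
  assumes "Re (b * cnj b) < 1"
  shows "1 - b * cnj b \<noteq> 0" "1 + b * cnj b \<noteq> 0"
proof -
  have "0 < Re (1 - b * cnj b)" using assms by (simp only: minus_complex.sel one_complex.sel)
  then show "1 - b * cnj b \<noteq> 0" by (metis less_irrefl zero_complex.sel(1))
  have "0 \<le> Re (b * cnj b)" by simp
  then have "Re (1 + b * cnj b) \<noteq> 0" by (simp only: plus_complex.sel one_complex.sel)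
  then show "1 + b * cnj b \<noteq> 0" by (metis zero_complex.sel(1))
qed

text \<open>Duality turns equations between forms into equations between components, by evaluation
  on frame vectors.\<close>

lemma cext_coframe_frame:
  assumes "tetrad_params U p" "x \<in> U"
  shows "cext (coframe S p J x) (frame S p x K) = (if J = K then 1 else 0)"
proof -
  have nz: "Phi_of p x \<noteq> 0" "alpha_of p x \<noteq> 0" "1 - b_of p x * cnj (b_of p x) \<noteq> 0"
    using assms one_minus_bb_nonzero unfolding tetrad_params_def by auto
  have low: "cext (coframe S p (L i) x) (lowvec p x t) = t i" for t i
  proof (cases i)
    case Ip
    with nz show ?thesis
      by (simp add: lowvec_def Let_def cext_add cext_cmult cext_beta)
        (simp add: divide_simps, simp add: algebra_simps)
  next
    case Im
    with nz show ?thesis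
      by (simp add: lowvec_def Let_def cext_add cext_cmult cext_beta)
        (simp add: divide_simps, simp add: algebra_simps)
  qed (use nz in \<open>simp_all add: lowvec_def Let_def cext_add cext_cmult cext_beta\<close>)
  have low': "cext co_s (lowvec p x t) = 0"
    "cext (cj co_s) (lowvec p x t) = 0" for t
    by (simp_all add: lowvec_def Let_def differential_co cext_co)
  have high: "cext (coframe S p (L i) x) (cvec (co_W x) (S x) (co_R x) (T S x) 1 0) = 0"
    "cext (coframe S p (L i) x) (cvec (cnj (co_W x)) (co_R x) (cj S x) (cj (T S) x) 0 1) = 0" for i
    by (cases i; simp add: cext_add cext_cmult cext_beta)+
  show ?thesis
    by (cases J; cases K)
      (use low low' high in \<open>auto simp: Dvec_def differential_co cext_co simp del: coframe.simps(1-4)\<close>)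
qed

lemma cext_form_of: "cext (form_of S p w x) E = (\<Sum>K\<in>UNIV. w K x * cext (coframe S p K x) E)"
  unfolding form_of_def[abs_def] by (rule cext_sum)

lemma cext_form_of_frame:
  assumes "tetrad_params U p" "x \<in> U"
  shows "cext (form_of S p w x) (frame S p x K) = w K x"
  by (simp add: cext_form_of cext_coframe_frame[OF assms] if_distrib[of "(*) _"] cong: if_cong)

section \<open>Components of the connection\<close>

lemma torsion_free_cext:
  assumes "torsion_free_weyl_connection U S p \<omega> A" "x \<in> U"
  shows "cext2 (ext_deriv (coframe S p (L i)) x) E F
    = - (\<Sum>k\<in>UNIV. \<Sum>j\<in>UNIV. eta i k *
        (cext (form_of S p (\<omega> k j) x) E * cext (coframe S p (L j) x) F
         - cext (form_of S p (\<omega> k j) x) F * cext (coframe S p (L j) x) E))"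
proof -
  have "ext_deriv (coframe S p (L i)) x u v
      + (\<Sum>k\<in>UNIV. \<Sum>j\<in>UNIV. eta i k * wedge (form_of S p (\<omega> k j)) (coframe S p (L j)) x u v) = 0" for u v
    using assms unfolding torsion_free_weyl_connection_def by blast
  then have "cext2 (\<lambda>u v. ext_deriv (coframe S p (L i)) x u v
      + (\<Sum>k\<in>UNIV. \<Sum>j\<in>UNIV. eta i k * wedge (form_of S p (\<omega> k j)) (coframe S p (L j)) x u v)) E F
     = cext2 (\<lambda>u v. 0) E F"
    by (simp only:)
  then show ?thesis
    by (simp add: cext2_add cext2_sum' cext2_cmult cext2_wedge eq_neg_iff_add_eq_0)
      (simp add: cext2_def cext_def)
qed

lemma weyl_symmetric_part:
  assumes tetrad: "tetrad_params U p" and weyl: "torsion_free_weyl_connection U S p \<omega> A"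
    and x: "x \<in> U"
  shows "\<omega> i j K x + \<omega> j i K x = 2 * eta i j * A K x"
proof -
  have "form_of S p (\<omega> i j) x = (\<lambda>u. (1/2) * (form_of S p (\<omega> i j) x u - form_of S p (\<omega> j i) x u)
      + eta i j * form_of S p A x u)"
    using weyl x unfolding torsion_free_weyl_connection_def by (auto simp: fun_eq_iff)
  then have "cext (form_of S p (\<omega> i j) x) (frame S p x K) = cext \<dots> (frame S p x K)"
    by (rule arg_cong)
  then show ?thesis
    by (simp only: cext_add cext_cmult cext_diff cext_form_of_frame[OF tetrad x])
      (simp add: field_simps)
qed

text \<open>On two frame vectors the torsion equation reads \<open>\<Delta>\<close>_iJK =
  \<open>\<omega>\<close>_iJK - \<open>\<omega>\<close>_iKJ. The connection has no middle index
  \<open>Is\<close> or \<open>Is_conj\<close>; the conditional sums set such terms to zero.\<close>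

lemma lowered_structure_functions:
  assumes tetrad: "tetrad_params U p" and weyl: "torsion_free_weyl_connection U S p \<omega> A"
    and struct: "structure_functions U S p \<Delta>" and x: "x \<in> U"
  shows "lowered \<Delta> i J K x = (\<Sum>j\<in>UNIV. (if L j = J then \<omega> i j K x else 0)
    - (if L j = K then \<omega> i j J x else 0))"
proof -
  define \<tau> where "\<tau> k j = (if L j = K then \<omega> k j J x else 0) - (if L j = J then \<omega> k j K x else 0)" for k j
  have "\<Delta> l J K x = - (\<Sum>k\<in>UNIV. \<Sum>j\<in>UNIV. eta l k * \<tau> k j)" for l
  proof -
    have "ext_deriv (coframe S p (L l)) x = (\<lambda>u v. 1/2 * (\<Sum>J\<in>UNIV. \<Sum>K\<in>UNIV.
        \<Delta> l J K x * wedge (coframe S p J) (coframe S p K) x u v))"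
      using struct x unfolding structure_functions_def by (intro ext) blast
    then have "cext2 (ext_deriv (coframe S p (L l)) x) (frame S p x J) (frame S p x K)
      = 1/2 * (\<Sum>J'\<in>UNIV. \<Sum>K'\<in>UNIV. \<Delta> l J' K' x *
        ((if J' = J then 1 else 0) * (if K' = K then 1 else 0)
          - (if J' = K then 1 else 0) * (if K' = J then 1 else 0)))"
      by (simp only: cext2_cmult cext2_sum' cext2_wedge cext_coframe_frame[OF tetrad x])
    also have "\<dots> = 1/2 * (\<Delta> l J K x - \<Delta> l K J x)"
      by (simp add: right_diff_distrib sum_subtractf mult_delta_left mult_delta_right)
    also have "\<dots> = \<Delta> l J K x"
    proof -
      have "\<Delta> l J K x = - \<Delta> l K J x"
        using struct x unfolding structure_functions_def by blast
      then show ?thesis by simp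
    qed
    finally show ?thesis
      unfolding torsion_free_cext[OF weyl x] cext_form_of_frame[OF tetrad x]
        cext_coframe_frame[OF tetrad x]
      by (simp add: \<tau>_def mult_delta_left mult_delta_right cong: if_cong)
  qed
  \<comment> \<open>Lowering by \<open>eta\<close> undoes the raising in the torsion equation, since
    \<open>eta\<close> is its own inverse.\<close>
  then have "lowered \<Delta> i J K x = - (\<Sum>j\<in>UNIV. \<tau> i j)"
    unfolding lowered_def by (cases i) (simp_all add: UNIV_idx)
  then show ?thesis by (simp add: \<tau>_def sum_negf[symmetric])
qed

text \<open>For a third index \<open>Is\<close> or \<open>Is_conj\<close> the torsion equation has a
  single connection term. For three lower-case indices the cyclic combination of torsion equations
  is solved with the three symmetry conditions, as for Christoffel symbols.\<close>

lemma weyl_connection_components: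
  assumes tetrad: "tetrad_params U p" and weyl: "torsion_free_weyl_connection U S p \<omega> A"
    and struct: "structure_functions U S p \<Delta>" and x: "x \<in> U"
  shows "\<omega> i j Is x = lowered \<Delta> i (L j) Is x"
    "\<omega> i j Is_conj x = lowered \<Delta> i (L j) Is_conj x"
    "\<omega> i j (L k) x =
       eta i j * A (L k) x - eta j k * A (L i) x + eta k i * A (L j) x
       + 1 / 2 * (lowered \<Delta> i (L j) (L k) x - lowered \<Delta> k (L i) (L j) x
                  + lowered \<Delta> j (L k) (L i) x)"
proof -
  note low = lowered_structure_functions[OF tetrad weyl struct x]
  note sym = weyl_symmetric_part[OF tetrad weyl x]
  show "\<omega> i j Is x = lowered \<Delta> i (L j) Is x" "\<omega> i j Is_conj x = lowered \<Delta> i (L j) Is_conj x"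
    by (simp_all add: low)
  show "\<omega> i j (L k) x =
       eta i j * A (L k) x - eta j k * A (L i) x + eta k i * A (L j) x
       + 1 / 2 * (lowered \<Delta> i (L j) (L k) x - lowered \<Delta> k (L i) (L j) x
                  + lowered \<Delta> j (L k) (L i) x)"
    using sym[of i j "L k"] sym[of j k "L i"] sym[of k i "L j"]
    by (simp add: low sum_subtractf) (simp add: field_simps)
qed

section \<open>The tetrad equations along D\<close>

text \<open>The tetrad forms vanish on \<open>Dvec\<close>, so d \<open>\<theta>\<close>^i(X, D) is
  linear in \<open>\<theta>\<close>^j(X) with coefficients \<open>\<omega>\<close>_kj at
  \<open>Is\<close>. Contraction with \<open>\<theta>\<close>_i(X) leaves only the symmetric part,
  which is \<open>eta\<close> times the Weyl component.\<close>

lemma weyl_contraction: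
  assumes tetrad: "tetrad_params U p" and weyl: "torsion_free_weyl_connection U S p \<omega> A"
    and x: "x \<in> U"
  defines "X z w w' r \<equiv> cvec z w w' r 0 0"
  defines "t i z w w' r \<equiv> cext (coframe S p (L i) x) (X z w w' r)"
    and "d i z w w' r \<equiv> cext2 (ext_deriv (coframe S p (L i)) x) (X z w w' r) (Dvec S x)"
  shows "t I0 z w w' r * d I1 z w w' r + t I1 z w w' r * d I0 z w w' r
      - t Ip z w w' r * d Im z w w' r - t Im z w w' r * d Ip z w w' r
    = 2 * A Is x * (t I0 z w w' r * t I1 z w w' r - t Ip z w w' r * t Im z w w' r)"
proof -
  have D0: "cext (coframe S p (L i) x) (Dvec S x) = 0" for i
    using cext_coframe_frame[OF tetrad x, of S "L i" Is] by simp
  have \<omega>: "cext (form_of S p (\<omega> k j) x) (Dvec S x) = \<omega> k j Is x" for k j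
    using cext_form_of_frame[OF tetrad x, of S "\<omega> k j" Is] by simp
  have d: "d i z w w' r = (\<Sum>k\<in>UNIV. \<Sum>j\<in>UNIV. eta i k * (\<omega> k j Is x * t j z w w' r))" for i
    unfolding d_def t_def torsion_free_cext[OF weyl x] D0 \<omega> by (simp add: sum_negf)
  define \<sigma> where "\<sigma> i j = \<omega> i j Is x" for i j
  have sym: "\<sigma> i j = 2 * eta i j * A Is x - \<sigma> j i" for i j
    using weyl_symmetric_part[OF tetrad weyl x, of i j Is] by (simp add: algebra_simps \<sigma>_def)
  \<comment> \<open>The diagonal of \<open>eta\<close> is zero, so the symmetry condition makes the
    diagonal of \<open>\<sigma>\<close> vanish.\<close>
  have diag: "\<sigma> i i = 0" for i
    using sym[of i i] by (cases i) simp_all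
  show ?thesis
    unfolding d \<sigma>_def[symmetric] UNIV_idx
    by (simp add: diag sym[of I0 I1] sym[of I0 Ip] sym[of I0 Im] sym[of I1 Ip] sym[of I1 Im]
        sym[of Ip Im] algebra_simps)
qed

text \<open>The derivative F' of the conformal parameter contributes only a multiple of the
  quadratic form itself. It is absorbed, together with A, into the unknown factor.\<close>

lemma conformal_scaling:
  fixes F F' al al' A :: complex
  assumes "F \<noteq> 0"
    and "F*l0 * (- (F*l1' + F'*l1)) + F*l1 * (- (F'*l0 + F*l0'))
      - F*al*lp * (- (F*al*lm' + (F*al' + F'*al)*lm)) - F*al*lm * (- (F*al*lp' + (F*al' + F'*al)*lp))
      = 2*A*(F*l0*(F*l1) - F*al*lp*(F*al*lm))"
  shows "l0*l1' + l1*l0' - al^2*(lp*lm' + lm*lp') - 2*al*al'*lp*lm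
    = (- 2*A - 2*F'/F) * (l0*l1 - al^2*lp*lm)"
proof -
  have "F*F*(l0*l1' + l1*l0' - al^2*(lp*lm' + lm*lp') - 2*al*al'*lp*lm)
    = F*((- 2*A*F - 2*F') * (l0*l1 - al^2*lp*lm))"
    using assms(2) by algebra
  also have "- 2*A*F - 2*F' = F*(- 2*A - 2*F'/F)"
    using assms(1) by (simp add: field_simps)
  finally show ?thesis using assms(1) by simp
qed

text \<open>The hypothesis says that the Lie derivative along D of the quadratic form
  \<open>\<theta>\<^sup>0\<theta>\<^sup>1 - \<theta>\<^sup>+\<theta>\<^sup>-\<close>, for \<open>\<Phi> = 1\<close>, is a multiple of that form; primes denote derivatives along D.\<close>

lemma conformal_lie_derivative:
  fixes al al' b b' bs bs' a a' as as' c c' lam :: complex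
  assumes lie: "\<And>z w v r.
      z*(c'*z + a'*w + as' * v + c*w + a*(z*SZ + w*SW + v * SV + r*SR) + as*r
          + (z*TZ + w*TW + v * TV + r*TR))
      + (r + a*w + as * v + c*z)*w
      - al^2*((w + b * v)*(bs'*w + bs*(z*SZ + w*SW + v * SV + r*SR) + r)
        + (v + bs*w)*(b' * v + (z*SZ + w*SW + v * SV + r*SR) + b*r))
      - 2*al*al'*(w + b * v)*(v + bs*w)
      = lam*(z*(r + a*w + as * v + c*z) - al^2*(w + b * v)*(v + bs*w))"
  defines "k \<equiv> al^2*(1 + b*bs)" and "k' \<equiv> 2*al*al'*(1 + b*bs) + al^2*(b*bs' + bs*b')"
  shows "1 - k = 2*al^2*bs*SR" "k*SR + 2*al^2*b = 0"
    "TW + a' + a*SW + 2*c - 2*al^2*bs*SZ = lam*a"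
    "a - (2*al*al'*bs + al^2*bs') - 2*al^2*bs*SW = - lam*al^2*bs"
    "as - k' - k*SW - 2*al^2*bs*SV = - lam*k"
    "k*SV + 2*al*al'*b + al^2*b' = lam*al^2*b"
proof -
  \<comment> \<open>Vectors along one axis give the coefficients of squares; subtracting these from
    the values at sums of two axes gives the mixed coefficients.\<close>
  show ww: "a - (2*al*al'*bs + al^2*bs') - 2*al^2*bs*SW = - lam*al^2*bs"
    using lie[of 0 1 0 0] by (simp add: algebra_simps power2_eq_square)
  show vv: "k*SV + 2*al*al'*b + al^2*b' = lam*al^2*b"
    using lie[of 0 0 1 0] unfolding k_def by (simp add: algebra_simps power2_eq_square)
  show "1 - k = 2*al^2*bs*SR"
    using lie[of 0 1 0 1] ww unfolding k_def by simp algebra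
  show "k*SR + 2*al^2*b = 0"
    using lie[of 0 0 1 1] vv unfolding k_def by simp algebra
  show "as - k' - k*SW - 2*al^2*bs*SV = - lam*k"
    using lie[of 0 1 1 0] ww vv unfolding k_def k'_def by simp algebra
  \<comment> \<open>The difference of the values at w = 1 and w = -1 isolates the coefficient of zw;
    the coefficient of the square of z, which contains c', drops out.\<close>
  show "TW + a' + a*SW + 2*c - 2*al^2*bs*SZ = lam*a"
    using lie[of 1 1 0 0] lie[of 1 "-1" 0 0] by simp algebra
qed

lemma tetrad_differentiable:
  assumes "tetrad_params U p" "x \<in> U"
  shows "(\<lambda>y. complex_of_real (Phi_of p y)) differentiable (at x)"
    "(\<lambda>y. complex_of_real (alpha_of p y)) differentiable (at x)"
    "b_of p differentiable (at x)" "a_of p differentiable (at x)"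
    "(\<lambda>y. complex_of_real (c_of p y)) differentiable (at x)"
  using assms smooth_on_differentiable differentiable_of_real unfolding tetrad_params_def by blast+

text \<open>The coefficient equations for the actual tetrad; \<open>k'\<close> is the derivative of
  \<open>k\<close> along \<open>D\<close>. Only the existence of \<open>lam\<close> is recorded, as
  it is eliminated afterwards.\<close>

lemma weyl_D_equations:
  assumes pde: "integrable_pde_pair U S" and tetrad: "tetrad_params U p"
    and weyl: "torsion_free_weyl_connection U S p \<omega> A" and x: "x \<in> U"
  defines "al \<equiv> complex_of_real (alpha_of p x)" and "b \<equiv> b_of p x" and "bs \<equiv> cnj (b_of p x)"
    and "a \<equiv> a_of p x" and "as \<equiv> cnj (a_of p x)" and "c \<equiv> complex_of_real (c_of p x)"
    and "al' \<equiv> D S (\<lambda>y. complex_of_real (alpha_of p y)) x"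
    and "b' \<equiv> D S (b_of p) x" and "bs' \<equiv> D S (cj (b_of p)) x" and "a' \<equiv> D S (a_of p) x"
  defines "k \<equiv> al^2*(1 + b*bs)" and "k' \<equiv> 2*al*al'*(1 + b*bs) + al^2*(b*bs' + bs*b')"
  obtains lam where
    "1 - k = 2*al^2*bs*par_R S x" "k*par_R S x + 2*al^2*b = 0"
    "par_W (T S) x + a' + a*par_W S x + 2*c - 2*al^2*bs*par_Z S x = lam*a"
    "a - (2*al*al'*bs + al^2*bs') - 2*al^2*bs*par_W S x = - lam*al^2*bs"
    "as - k' - k*par_W S x - 2*al^2*bs*par_W_conj S x = - lam*k"
    "k*par_W_conj S x + 2*al*al'*b + al^2*b' = lam*al^2*b"
proof -
  define Ff where "Ff = (\<lambda>y. complex_of_real (Phi_of p y))"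
  define alf where "alf = (\<lambda>y. complex_of_real (alpha_of p y))"
  define cf where "cf = (\<lambda>y. complex_of_real (c_of p y))"
  define F F' where "F = Ff x" and "F' = D S Ff x"
  define as' c' where "as' = D S (cj (a_of p)) x" and "c' = D S cf x"
  have F: "F \<noteq> 0" using tetrad x unfolding tetrad_params_def F_def Ff_def by auto
  have dS: "S differentiable (at x)" "T S differentiable (at x)"
    using pde x T_differentiable smooth_on_differentiable unfolding integrable_pde_pair_def by blast+
  note df = tetrad_differentiable[OF tetrad x, folded Ff_def alf_def cf_def]
  note dfc = df(3)[THEN differentiable_cj] df(4)[THEN differentiable_cj]
  note val = F_def[symmetric] F'_def[symmetric] al_def[symmetric] al'_def[symmetric] b_def[symmetric]
    b'_def[symmetric] bs_def[symmetric] bs'_def[symmetric] a_def[symmetric] a'_def[symmetric]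
    as_def[symmetric] as'_def[symmetric] c_def[symmetric] c'_def[symmetric]
  have vals: "cf x = c" "alf x = al" "D S alf x = al'" "cj (b_of p) x = bs" "cj (a_of p) x = as"
    by (simp_all add: cf_def c_def alf_def al_def al'_def cj_def bs_def as_def)
  have cj_fold: "cnj (b_of p y) = cj (b_of p) y" "cnj (a_of p y) = cj (a_of p) y" for y
    by (simp_all add: cj_def)
  define l0 lp lm l1 where
    "l0 = (\<lambda>(z::complex) (w::complex) (v::complex) (r::complex). z)"
    and "lp = (\<lambda>(z::complex) (w::complex) (v::complex) (r::complex). w + b * v)"
    and "lm = (\<lambda>(z::complex) (w::complex) (v::complex) (r::complex). v + bs*w)"
    and "l1 = (\<lambda>z w v r. r + a*w + as * v + c*z)"
  define P Q where
    "P = (\<lambda>z w v r. z*par_Z S x + w*par_W S x + v * par_W_conj S x + r*par_R S x)"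
    and "Q = (\<lambda>z w v r. z*par_Z (T S) x + w*par_W (T S) x + v * par_W_conj (T S) x + r*par_R (T S) x)"
  note l_defs = l0_def lp_def lm_def l1_def P_def Q_def
  let ?X = "\<lambda>z w v r. cvec z w v r 0 0"
  note contact = ext_deriv_contact[OF _ _ _ _ dS, folded Dvec_def]
  have t0: "cext (coframe S p (L I0) x) (?X z w v r) = F*l0 z w v r"
    and tp: "cext (coframe S p (L Ip) x) (?X z w v r) = F*al*lp z w v r"
    and tm: "cext (coframe S p (L Im) x) (?X z w v r) = F*al*lm z w v r"
    and t1: "cext (coframe S p (L I1) x) (?X z w v r) = F*l1 z w v r" for z w v r
    by (simp_all add: cext_add cext_cmult cext_beta l_defs F_def Ff_def al_def b_def bs_def a_def
        as_def c_def)
  \<comment> \<open>Each tetrad form is a combination of contact forms; the product rule separates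
    the terms in F' and al', which are multiples of the form itself.\<close>
  have d0: "cext2 (ext_deriv (coframe S p (L I0)) x) (?X z w v r) (Dvec S x)
      = - (F'*l0 z w v r + F*w)" for z w v r
    by (subst contact[where ?f0.0 = Ff and fp = "\<lambda>_. 0" and fm = "\<lambda>_. 0" and ?f1.0 = "\<lambda>_. 0"])
      (simp_all add: df Ff_def[symmetric] fun_cong[OF Ff_def, symmetric] D_const val l_defs)
  have dp: "cext2 (ext_deriv (coframe S p (L Ip)) x) (?X z w v r) (Dvec S x)
      = - (F*al*(b' * v + P z w v r + b*r) + (F*al' + F'*al)*lp z w v r)" for z w v r
    by (subst contact[where ?f0.0 = "\<lambda>_. 0" and fp = "\<lambda>y. Ff y * alf y"
          and fm = "\<lambda>y. Ff y * alf y * b_of p y" and ?f1.0 = "\<lambda>_. 0"])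
      (simp_all add: df differentiable_mult fun_cong[OF Ff_def, symmetric] fun_cong[OF alf_def, symmetric]
        D_const D_mult val vals l_defs algebra_simps)
  have dm: "cext2 (ext_deriv (coframe S p (L Im)) x) (?X z w v r) (Dvec S x)
      = - (F*al*(bs'*w + bs*P z w v r + r) + (F*al' + F'*al)*lm z w v r)" for z w v r
    by (subst contact[where ?f0.0 = "\<lambda>_. 0" and fp = "\<lambda>y. Ff y * alf y * cj (b_of p) y"
          and fm = "\<lambda>y. Ff y * alf y" and ?f1.0 = "\<lambda>_. 0"])
      (simp_all add: df dfc differentiable_mult fun_cong[OF Ff_def, symmetric] fun_cong[OF alf_def, symmetric]
        cj_fold D_const D_mult val vals l_defs algebra_simps)
  have d1: "cext2 (ext_deriv (coframe S p (L I1)) x) (?X z w v r) (Dvec S x)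
      = - (F*(c'*z + a'*w + as' * v + c*w + a*P z w v r + as*r + Q z w v r) + F'*l1 z w v r)" for z w v r
    by (subst contact[where ?f0.0 = "\<lambda>y. Ff y * cf y" and fp = "\<lambda>y. Ff y * a_of p y"
          and fm = "\<lambda>y. Ff y * cj (a_of p) y" and ?f1.0 = Ff])
      (simp_all add: df dfc differentiable_mult fun_cong[OF Ff_def, symmetric] fun_cong[OF cf_def, symmetric]
        cj_fold D_const D_mult val vals l_defs algebra_simps)
  have "l0 z w v r * (c'*z + a'*w + as' * v + c*w + a*P z w v r + as*r + Q z w v r)
      + l1 z w v r * w
      - al^2*(lp z w v r*(bs'*w + bs*P z w v r + r) + lm z w v r*(b' * v + P z w v r + b*r))
      - 2*al*al'*lp z w v r*lm z w v r
      = (- 2*A Is x - 2*F'/F) * (l0 z w v r*l1 z w v r - al^2*lp z w v r*lm z w v r)" for z w v r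
    using weyl_contraction[OF tetrad weyl x, of z w v r, unfolded t0 t1 tp tm d0 dp dm d1]
    by (intro conformal_scaling[OF F]) (simp only: mult.assoc)
  note conformal_lie_derivative[OF this[unfolded l_defs]]
  then show thesis by (intro that) (simp_all only: k_def k'_def)
qed

section \<open>Solution of the tetrad equations\<close>

text \<open>In the following lemmas al2 is the square of the parameter alpha and d2 its derivative along D,
  q = b bs, and u, us are the derivatives of b and bs along the conjugate of D.\<close>

lemma alpha_b_algebra:
  fixes al2 b bs SR :: "'a::field"
  assumes "1 - al2*(1 + b*bs) = 2*al2*bs*SR" "al2*(1 + b*bs)*SR + 2*al2*b = 0" "al2 \<noteq> 0"
  shows "(1 + b*bs)*SR = - 2*b" "al2*(1 - b*bs)^2 = 1 + b*bs"
proof -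
  have "al2*((1 + b*bs)*SR + 2*b) = 0" using assms(2) by (simp add: algebra_simps)
  then have "(1 + b*bs)*SR + 2*b = 0" using assms(3) by simp
  then show SR: "(1 + b*bs)*SR = - 2*b" by (simp add: add_eq_0_iff2)
  \<comment> \<open>The first equation times \<open>1 + b*bs\<close> contains SR only through the
    product just found.\<close>
  have "1 + b*bs = al2*(1 + b*bs)^2 + 2*al2*bs*((1 + b*bs)*SR)"
    using assms(1) by algebra
  then show "al2*(1 - b*bs)^2 = 1 + b*bs" unfolding SR by algebra
qed

text \<open>Adding b times the first equation to bs times the second removes both \<open>lam\<close>
  and \<open>d2\<close>.\<close>

lemma a_from_D:
  fixes al2 :: "'a::field"
  assumes "a - (d2*bs + al2*bs') - 2*al2*bs*SW = - lam*al2*bs"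
    and "al2*(1 + b*bs)*SV + d2*b + al2*b' = lam*al2*b"
  shows "b*a = al2*(b*bs' - bs*b' + 2*b*bs*SW - bs*(1 + b*bs)*SV)"
  using assms by algebra

lemma a_from_D_conj:
  fixes al2 :: "'a::field"
  assumes "a - (d2*(1 + b*bs) + al2*(b*us + bs*u)) - al2*(1 + b*bs)*SWs - 2*al2*b*SVs
      = - lam*(al2*(1 + b*bs))"
    and "al2*(1 + b*bs)*SVs + d2*bs + al2*us = lam*al2*bs"
  shows "bs*a = al2*(bs^2*u - us + (1 + b*bs)*bs*SWs - (1 + b^2*bs^2)*SVs)"
  using assms by algebra

text \<open>Both hypotheses determine the product b bs a; equating the two values eliminates a. The
  bracket on the right is the numerator of the Wuenschmann function, and the one on the left is its
  conjugate.\<close>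

lemma wuenschmann_relation:
  fixes al2 :: "'a::field"
  assumes "b*a = al2*(b*bs' - bs*b' + 2*b*bs*SW - bs*(1 + b*bs)*SV)"
    and "bs*a = al2*(bs^2*u - us + (1 + b*bs)*bs*SWs - (1 + b^2*bs^2)*SVs)"
    and "al2 \<noteq> 0"
  shows "b*(us + bs*bs' + SVs - bs*SWs + bs^2*SW - bs^3*SV)
    = bs^2*(b' + b*u + SV - b*SW + b^2*SWs - b^3*SVs)"
proof -
  have "al2*(b*(us + bs*bs' + SVs - bs*SWs + bs^2*SW - bs^3*SV))
    = al2*(bs^2*(b' + b*u + SV - b*SW + b^2*SWs - b^3*SVs))"
    using assms(1,2) by algebra
  then show ?thesis using assms(3) by simp
qed

text \<open>The relation between al2 and q, and its derivative along \<open>D\<close> (hypothesis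
  \<open>d2\<close>), suffice to eliminate d2, b' and bs'. No step divides by b, so points with b =
  0 are included.\<close>

lemma lam_algebra:
  fixes al2 :: "'a::field"
  assumes vv: "al2*(1 + b*bs)*SV + d2*b + al2*b' = lam*al2*b"
    and ww: "a - (d2*bs + al2*bs') - 2*al2*bs*SW = - lam*al2*bs"
    and wv: "as - (d2*(1 + b*bs) + al2*(b*bs' + bs*b')) - al2*(1 + b*bs)*SW - 2*al2*bs*SV
      = - lam*(al2*(1 + b*bs))"
    and al2: "al2*(1 - b*bs)^2 = 1 + b*bs"
    and d2: "d2*(1 - b*bs)^2 - 2*al2*(1 - b*bs)*(b*bs' + bs*b') = b*bs' + bs*b'"
  shows "(lam - SW)*(1 + b*bs)^2
    = 4*a*b*(1 + b*bs) - 2*bs*SV*(1 + b*bs) - as*(1 + 6*b*bs + b^2*bs^2)"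
proof -
  \<comment> \<open>Here \<open>M\<close> is not the Wuenschmann function but the combination
    through which \<open>lam\<close>, SW and d2 enter; the three equations are linear in it.\<close>
  define q m K q' M where "q = b*bs" and "m = 1 - q" and "K = 1 + q" and "q' = b*bs' + bs*b'"
    and "M = al2*(lam - SW) - d2"
  have mK: "m + K = 2" "m = 1 - q" "K = 1 + q" by (simp_all add: m_def K_def)
  have vv': "al2*b' = M*b + al2*b*SW - al2*K*SV"
    using vv unfolding M_def K_def q_def by algebra
  have ww': "al2*bs' = a + M*bs - al2*bs*SW"
    using ww unfolding M_def K_def q_def by algebra
  have wv': "M*K = al2*q' + 2*al2*bs*SV - as"
    using wv unfolding M_def K_def q_def q'_def by algebra
  have al2q': "al2*q' = 2*M*q + a*b - al2*bs*K*SV"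
    using vv' ww' unfolding q'_def q_def by algebra
  \<comment> \<open>Inserting the value of al2 q' uses K - 2q = m and 2 - K = m.\<close>
  have Mm: "M*m = a*b - as + al2*bs*SV*m"
    using wv' al2q' unfolding mK(2,3) by algebra
  have K2: "al2*m^2 = K" using al2 by (simp add: m_def K_def q_def)
  have X: "al2*q'*m = a*b*K - 2*q*as - K*bs*SV"
  proof -
    have "al2*q'*m = 2*q*(M*m) + a*b*m - al2*bs*K*m*SV" unfolding al2q' by algebra
    also have "\<dots> = a*b*K - 2*q*as - (al2*m^2)*bs*SV" unfolding Mm unfolding mK(2,3) by algebra
    finally show ?thesis unfolding K2 .
  qed
  \<comment> \<open>The differentiated relation is multiplied by m; then al2 m^2 = K and m + 2K = 3
    + q.\<close>
  have d2m: "d2*m^3 = q'*(3 + q)"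
  proof -
    have "d2*m^2 - 2*al2*m*q' = q'" using d2 by (simp add: m_def q_def q'_def)
    then have d2: "d2*m^2 = q' + 2*al2*m*q'" by (simp add: diff_eq_eq)
    have "d2*m^3 = (d2*m^2)*m" by algebra
    also have "\<dots> = q'*m + 2*(al2*m^2)*q'" unfolding d2 by algebra
    finally show ?thesis unfolding K2 unfolding mK(2,3) by algebra
  qed
  have "(lam - SW)*K^2 = (lam - SW)*(al2*m^2)*K" unfolding K2 by algebra
  also have "\<dots> = (M + d2)*m^2*K" unfolding M_def by algebra
  also have "\<dots> = (M*m)*m*K + d2*m^2*(al2*m^2)" unfolding K2 by algebra
  also have "\<dots> = (M*m)*m*K + (d2*m^3)*(al2*m)" by algebra
  also have "\<dots> = (a*b - as + al2*bs*SV*m)*m*K + (3 + q)*(al2*q'*m)" unfolding d2m Mm by algebra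
  also have "\<dots> = (a*b - as)*m*K + bs*SV*(al2*m^2)*K + (3 + q)*(a*b*K - 2*q*as - K*bs*SV)"
    unfolding X by algebra
  also have "\<dots> = 4*a*b*K - 2*bs*SV*K - as*(1 + 6*q + q^2)"
    unfolding K2 unfolding mK(2,3) by algebra
  finally show ?thesis by (simp add: K_def q_def power_mult_distrib algebra_simps)
qed

text \<open>With n = |b|^2, the relation gives |S_R| = 2|b|/(1 + n), so the radicand is the square
  of r = (1 - n)/(1 + n). Since n < 1, r is positive and is the principal root.\<close>

lemma b_root_eq:
  assumes S: "S differentiable (at x)" and b: "Re (b * cnj b) < 1"
    and SR: "(1 + b * cnj b) * par_R S x = - 2 * b"
  shows "b_root S x = b"
proof (cases "b = 0")
  case True
  then have "par_R S x = 0" using SR by simp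
  then show ?thesis using True by (simp add: b_root_def par_cj[OF S])
next
  case False
  define n where "n = (cmod b)^2"
  have n: "b * cnj b = of_real n" unfolding n_def complex_norm_square[symmetric] by simp
  have n_bounds: "0 \<le> n" "n < 1" using b unfolding n by (simp_all add: n_def)
  define r where "r = (1 - n) / (1 + n)"
  have nz: "1 + complex_of_real n \<noteq> 0"
    using one_minus_bb_nonzero(2)[OF b] unfolding n .
  have R: "par_R S x = - 2 * b / (1 + of_real n)"
    using SR nz unfolding n by (simp add: field_simps)
  then have Rs: "par_R (cj S) x = - 2 * cnj b / (1 + of_real n)"
    by (simp add: par_cj[OF S])
  have "1 - par_R S x * par_R (cj S) x = 1 - 4 * (b * cnj b) / (1 + of_real n)^2"
    unfolding R Rs by (simp add: power2_eq_square)
  also have "\<dots> = ((1 + of_real n)^2 - 4 * of_real n) / (1 + of_real n)^2"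
    unfolding n using nz by (simp add: diff_divide_distrib)
  also have "(1 + of_real n)^2 - 4 * of_real n = (1 - complex_of_real n)^2"
    by (simp add: power2_eq_square algebra_simps)
  also have "\<dots> / (1 + of_real n)^2 = (of_real r)^2"
    by (simp add: r_def power_divide)
  finally have "csqrt (1 - par_R S x * par_R (cj S) x) = of_real r"
    using n_bounds csqrt_square[of "of_real r"] by (simp add: r_def)
  then have "b_root S x = (-1 + of_real r) / par_R (cj S) x"
    using False nz by (simp add: b_root_def Rs)
  also have "\<dots> = of_real n / cnj b"
  proof -
    have "-1 + complex_of_real r = - 2 * of_real n / (1 + of_real n)"
      unfolding r_def using nz by (simp add: field_simps)
    then show ?thesis using nz False unfolding Rs by simp
  qed
  also have "\<dots> = b" using False by (simp add: n[symmetric])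
  finally show ?thesis .
qed

text \<open>The values of b and of alpha squared hold at every point of U, so they can later be
  differentiated.\<close>

lemma weyl_b_alpha:
  assumes pde: "integrable_pde_pair U S" and tetrad: "tetrad_params U p"
    and weyl: "torsion_free_weyl_connection U S p \<omega> A" and x: "x \<in> U"
  defines "q \<equiv> b_of p x * cnj (b_of p x)"
  shows "b_root S x = b_of p x" "complex_of_real (alpha_of p x)^2 * (1 - q)^2 = 1 + q"
    "1 - q \<noteq> 0" "1 + q \<noteq> 0"
proof -
  have "alpha_of p x \<noteq> 0" and b: "Re (b_of p x * cnj (b_of p x)) < 1"
    using tetrad x unfolding tetrad_params_def by blast+
  then have al: "complex_of_real (alpha_of p x)^2 \<noteq> 0" by simp
  obtain lam where
    "1 - complex_of_real (alpha_of p x)^2 * (1 + b_of p x * cnj (b_of p x))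
      = 2 * complex_of_real (alpha_of p x)^2 * cnj (b_of p x) * par_R S x"
    "complex_of_real (alpha_of p x)^2 * (1 + b_of p x * cnj (b_of p x)) * par_R S x
      + 2 * complex_of_real (alpha_of p x)^2 * b_of p x = 0"
    using weyl_D_equations[OF pde tetrad weyl x] by metis
  note alg = alpha_b_algebra[OF this al]
  have "S differentiable (at x)"
    using pde x smooth_on_differentiable unfolding integrable_pde_pair_def by blast
  then show "b_root S x = b_of p x" using b_root_eq b alg(1) by blast
  show "complex_of_real (alpha_of p x)^2 * (1 - q)^2 = 1 + q" using alg(2) by (simp add: q_def)
  show "1 - q \<noteq> 0" "1 + q \<noteq> 0" using one_minus_bb_nonzero[OF b] by (simp_all add: q_def)
qed

text \<open>The value of a at points with b = 0 is listed separately because the general formula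
  divides by b; uniqueness of a requires both cases.\<close>

lemma weyl_tetrad_parameters:
  assumes pde: "integrable_pde_pair U S" and tetrad: "tetrad_params U p"
    and weyl: "torsion_free_weyl_connection U S p \<omega> A" and x: "x \<in> U"
  defines "b \<equiv> b_of p x" and "bs \<equiv> cj (b_of p) x" and "a \<equiv> a_of p x" and "as \<equiv> cj (a_of p) x"
  shows "b = 0 \<Longrightarrow> a = D S (cj (b_of p)) x"
    and "b \<noteq> 0 \<Longrightarrow> a = inverse b * inverse bs * inverse ((1 - b * bs)^2) * (1 + b * bs) *
              (bs^2 * (- D S (b_of p) x + b * par_W S x - par_W_conj S x)
               + b * (- D_conj S (cj (b_of p)) x + bs * par_W_conj (cj S) x - par_W (cj S) x))"
    and "complex_of_real (c_of p x) =
          - (D S (a_of p) x + D_conj S (cj (a_of p)) x + par_W (T S) x + par_W_conj (cj (T S)) x) / 4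
          - a * as * (1 + 6 * b * bs + b^2 * bs^2) / (2 * (1 + b * bs)^2)
          + (1 + b * bs) * (b * par_Z (cj S) x + bs * par_Z S x) / (2 * (1 - b * bs)^2)
          + (a * (2 * a * b - bs * par_W_conj S x) + as * (2 * as * bs - b * par_W (cj S) x))
            / (2 * (1 + b * bs))"
    and "wuenschmann S x = 0"
proof -
  define al2 where "al2 = complex_of_real (alpha_of p x)^2"
  define al al' where "al = complex_of_real (alpha_of p x)"
    and "al' = D S (\<lambda>y. complex_of_real (alpha_of p y)) x"
  define d2 where "d2 = 2 * al * al'"
  define b' bs' a' where "b' = D S (b_of p) x" and "bs' = D S (cj (b_of p)) x"
    and "a' = D S (a_of p) x"
  define u us where "u = cnj bs'" and "us = cnj b'"
  define c where "c = complex_of_real (c_of p x)"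
  define SW SV SZ TW where "SW = par_W S x" and "SV = par_W_conj S x" and "SZ = par_Z S x"
    and "TW = par_W (T S) x"
  note defs = b_def bs_def a_def as_def al_def al'_def b'_def bs'_def a'_def c_def SW_def SV_def
    SZ_def TW_def
  have U: "open U" using pde unfolding integrable_pde_pair_def by blast
  have dS: "S differentiable (at x)" "T S differentiable (at x)"
    using pde x T_differentiable smooth_on_differentiable unfolding integrable_pde_pair_def by blast+
  note df = tetrad_differentiable[OF tetrad x]
  note ba = weyl_b_alpha[OF pde tetrad weyl x, folded cj_def[of "b_of p"], folded b_def bs_def al2_def]
  have conj: "cnj b = bs" "cnj bs = b" "cnj a = as" "cnj as = a" "cnj al2 = al2" "cnj c = c"
    "cnj u = bs'" "cnj us = b'"
    by (simp_all add: b_def bs_def a_def as_def al2_def c_def u_def us_def cj_def)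
  have al2_eq: "al2 = al^2" and al2: "al2 \<noteq> 0" and cnj_d2: "cnj al = al"
    using tetrad x unfolding tetrad_params_def by (auto simp: al2_def al_def)
  obtain lam where eqs:
    "TW + a' + a*SW + 2*c - 2*al2*bs*SZ = lam*a"
    "a - (d2*bs + al2*bs') - 2*al2*bs*SW = - lam*al2*bs"
    "as - (d2*(1 + b*bs) + al2*(b*bs' + bs*b')) - al2*(1 + b*bs)*SW - 2*al2*bs*SV
      = - lam*(al2*(1 + b*bs))"
    "al2*(1 + b*bs)*SV + d2*b + al2*b' = lam*al2*b"
    using weyl_D_equations[OF pde tetrad weyl x, folded cj_def[of "b_of p"] cj_def[of "a_of p"], folded defs, folded al2_eq d2_def]
    by metis
  \<comment> \<open>Conjugation yields the equations along \<open>D_conj\<close>, with u and us the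
    derivatives of b and bs.\<close>
  note eqs_conj = eqs[THEN arg_cong[where f = cnj], simplified complex_cnj_add complex_cnj_mult
      complex_cnj_diff complex_cnj_minus complex_cnj_one complex_cnj_numeral conj, folded u_def us_def]

  \<comment> \<open>The Wuenschmann condition\<close>
  have A1: "b*a = al2*(b*bs' - bs*b' + 2*b*bs*SW - bs*(1 + b*bs)*SV)"
    using a_from_D[OF eqs(2,4)] .
  have A2: "bs*a = al2*(bs^2*u - us + (1 + b*bs)*bs*cnj SW - (1 + b^2*bs^2)*cnj SV)"
    by (rule a_from_D_conj[of _ "cnj d2" _ _ _ _ _ _ _ "cnj lam"])
      (use eqs_conj(3,4) in \<open>simp_all add: algebra_simps\<close>)
  define N where "N = b' + b*u + SV - b*SW + b^2*cnj SW - b^3*cnj SV"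
  have cnj_N: "cnj N = us + bs*bs' + cnj SV - bs*cnj SW + bs^2*SW - bs^3*SV"
    by (simp add: N_def conj us_def u_def)
  have rel: "b * cnj N = bs^2 * N"
    unfolding cnj_N unfolding N_def by (rule wuenschmann_relation[OF A1 A2 al2])
  then have rel': "bs * N = b^2 * cnj N"
  proof -
    have "cnj (b * cnj N) = cnj (bs^2 * N)" by (simp only: rel)
    then show ?thesis by (simp only: complex_cnj_mult complex_cnj_power complex_cnj_cnj conj)
  qed
  have N: "N = 0"
  proof (cases "b = 0")
    case True
    then have "bs = 0" using conj(1) by simp
    with True al2 eqs(4) have "al2 * (SV + b') = 0" by (simp add: algebra_simps)
    with al2 True show ?thesis by (simp add: N_def add.commute)
  next
    case False
    then have "bs \<noteq> 0" using conj(2) by auto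
    \<comment> \<open>Eliminating \<open>cnj N\<close>: bs N = b (b cnj N) = b bs^2 N.\<close>
    have "bs * ((1 - b*bs) * N) = 0" using rel rel' by algebra
    then show ?thesis using \<open>bs \<noteq> 0\<close> ba(3) by simp
  qed
  have broot: "D S (b_root S) x = b'" "D_conj S (b_root S) x = u"
  proof -
    \<comment> \<open>The two functions agree on the whole open set U, so their derivatives agree
      too.\<close>
    have *: "b_root S y = b_of p y" if "y \<in> U" for y
      using weyl_b_alpha(1)[OF pde tetrad weyl that] .
    show "D S (b_root S) x = b'" unfolding b'_def by (rule D_cong[OF U x *])
    have "D_conj S (b_root S) x = D_conj S (cj (cj (b_of p))) x"
      using frechet_derivative_cong_open[OF U x *]
      by (simp add: D_conj_def par_Z_def par_W_def par_W_conj_def par_R_def par_s_def par_s_conj_def)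
    then show "D_conj S (b_root S) x = u"
      by (simp only: D_conj_cj[OF differentiable_cj[OF df(3)]] u_def bs'_def)
  qed
  show "wuenschmann S x = 0"
    unfolding wuenschmann_def Let_def broot ba(1) using N
    by (simp add: N_def par_cj[OF dS(1)] SW_def SV_def)

  \<comment> \<open>The parameter a\<close>
  show "a = D S (cj (b_of p)) x" if "b = 0"
  proof -
    have "bs = 0" using that conj(1) by simp
    then show ?thesis using eqs(2) ba(2) that by (simp add: bs'_def)
  qed
  have al2_frac: "al2 = (1 + b*bs) / (1 - b*bs)^2"
    using ba(2,3) by (simp add: field_simps)
  show "a = inverse b * inverse bs * inverse ((1 - b * bs)^2) * (1 + b * bs) *
              (bs^2 * (- D S (b_of p) x + b * par_W S x - par_W_conj S x)
               + b * (- D_conj S (cj (b_of p)) x + bs * par_W_conj (cj S) x - par_W (cj S) x))"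
    if "b \<noteq> 0"
  proof -
    have bs: "bs \<noteq> 0" using conj(2) that by auto
    let ?X = "bs^2 * (- b' + b*SW - SV) + b * (- us + bs*cnj SW - cnj SV)"
    \<comment> \<open>The conjugate Wuenschmann condition trades the derivative bs' along
      \<open>D\<close> for the derivative us along \<open>D_conj\<close>.\<close>
    have "us + bs*bs' + cnj SV - bs*cnj SW + bs^2*SW - bs^3*SV = 0"
      using N cnj_N by simp
    then have "bs*(b*a) = al2 * ?X"
      using A1 by algebra
    then have "a = inverse b * inverse bs * (al2 * ?X)"
      using that bs by (simp add: field_simps)
    also have "\<dots> = inverse b * inverse bs * inverse ((1 - b * bs)^2) * (1 + b * bs) * ?X"
      by (simp add: al2_frac divide_inverse)
    finally show ?thesis
      by (simp add: D_conj_cj[OF df(3)] par_cj[OF dS(1)] SW_def SV_def us_def b'_def)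
  qed

  \<comment> \<open>The factor \<open>lam\<close> and the parameter c\<close>
  have d2_eq: "d2*(1 - b*bs)^2 - 2*al2*(1 - b*bs)*(b*bs' + bs*b') = b*bs' + bs*b'"
  proof -
    define alf qf where "alf = (\<lambda>y. complex_of_real (alpha_of p y))"
      and "qf = (\<lambda>y. b_of p y * cj (b_of p) y)"
    have da: "alf differentiable (at x)" using df(2) by (simp add: alf_def)
    have dq: "qf differentiable (at x)"
      unfolding qf_def by (intro derivative_intros df(3) differentiable_cj)
    have Dq: "D S qf x = b*bs' + bs*b'"
      unfolding qf_def
      by (simp add: D_mult[OF df(3) differentiable_cj[OF df(3)]] b_def bs_def b'_def bs'_def)
    \<comment> \<open>The relation between alpha and b is differentiated along \<open>D\<close>,
      with differences written as sums to fit the rules for \<open>D\<close>.\<close>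
    have "D S (\<lambda>y. alf y * alf y * ((1 + - 1 * qf y) * (1 + - 1 * qf y))) x = D S (\<lambda>y. 1 + qf y) x"
      by (rule D_cong[OF U x])
        (use weyl_b_alpha(2)[OF pde tetrad weyl] in \<open>simp add: alf_def qf_def cj_def power2_eq_square\<close>)
    then show ?thesis
      by (simp only: D_mult D_add D_const da dq Dq differentiable_mult differentiable_add differentiable_const)
        (simp add: d2_def al2_eq alf_def qf_def al_def[symmetric] al'_def[symmetric] b_def[symmetric]
          bs_def[symmetric] power2_eq_square algebra_simps)
  qed
  have lam: "(lam - SW)*(1 + b*bs)^2
    = 4*a*b*(1 + b*bs) - 2*bs*SV*(1 + b*bs) - as*(1 + 6*b*bs + b^2*bs^2)"
    by (rule lam_algebra[OF eqs(4,2,3) ba(2) d2_eq])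
  have lam_eq: "lam - SW = (4*a*b - 2*bs*SV)/(1 + b*bs) - as*(1 + 6*b*bs + b^2*bs^2)/(1 + b*bs)^2"
    (is "_ = ?l")
  proof -
    have "(P / K - Q / K^2) * K^2 = P*K - Q" if "K \<noteq> 0" for P Q K :: complex
      using that by (simp add: field_simps power2_eq_square)
    from this[OF ba(4)] have "(lam - SW)*(1 + b*bs)^2 = ?l * (1 + b*bs)^2"
      unfolding lam by (simp only:) (simp add: algebra_simps)
    then show ?thesis using ba(4) by simp
  qed
  from arg_cong[of _ _ cnj, OF this]
  have cnj_lam_eq: "cnj (lam - SW) = (4*as*bs - 2*b*cnj SV)/(1 + b*bs) - a*(1 + 6*b*bs + b^2*bs^2)/(1 + b*bs)^2"
    by (simp add: conj ac_simps)
  have lam': "a*(lam - SW) + as*cnj (lam - SW)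
    = 4 * ((a * (2 * a * b - bs * SV) + as * (2 * as * bs - b * cnj SV)) / (2 * (1 + b * bs))
        - a * as * (1 + 6 * b * bs + b^2 * bs^2) / (2 * (1 + b * bs)^2))"
  proof -
    have "a * ((4*a*b - 2*bs*SV)/K - as*Q/K^2) + as * ((4*as*bs - 2*b*cnj SV)/K - a*Q/K^2)
      = 4 * ((a * (2 * a * b - bs * SV) + as * (2 * as * bs - b * cnj SV)) / (2 * K)
        - a * as * Q / (2 * K^2))" for Q K
      by (simp add: add_divide_distrib diff_divide_distrib algebra_simps)
    then show ?thesis unfolding cnj_lam_eq unfolding lam_eq .
  qed
  \<comment> \<open>The equation containing 2c is added to its conjugate, c being real.\<close>
  have "4*c = - (a' + cnj a' + TW + cnj TW) + 2*al2*(b*cnj SZ + bs*SZ)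
      + (a*(lam - SW) + as*cnj (lam - SW))"
    using eqs(1) eqs_conj(1) by (simp add: algebra_simps) algebra
  also have "\<dots> = 4 * (- (a' + cnj a' + TW + cnj TW) / 4
          - a * as * (1 + 6 * b * bs + b^2 * bs^2) / (2 * (1 + b * bs)^2)
          + (1 + b * bs) * (b * cnj SZ + bs * SZ) / (2 * (1 - b * bs)^2)
          + (a * (2 * a * b - bs * SV) + as * (2 * as * bs - b * cnj SV)) / (2 * (1 + b * bs)))"
  proof -
    have "- w + 2*(P/M)*Z + 4*(Y - X) = 4*(- w/4 - X + P*Z/(2*M) + Y)" for w P M X Y Z :: complex
      by (simp add: algebra_simps)
    then show ?thesis unfolding lam' al2_frac .
  qed
  finally have "c = - (a' + cnj a' + TW + cnj TW) / 4
          - a * as * (1 + 6 * b * bs + b^2 * bs^2) / (2 * (1 + b * bs)^2)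
          + (1 + b * bs) * (b * cnj SZ + bs * SZ) / (2 * (1 - b * bs)^2)
          + (a * (2 * a * b - bs * SV) + as * (2 * as * bs - b * cnj SV)) / (2 * (1 + b * bs))"
    by (rule mult_left_cancel[THEN iffD1, rotated]) simp
  then show "complex_of_real (c_of p x) =
          - (D S (a_of p) x + D_conj S (cj (a_of p)) x + par_W (T S) x + par_W_conj (cj (T S)) x) / 4
          - a * as * (1 + 6 * b * bs + b^2 * bs^2) / (2 * (1 + b * bs)^2)
          + (1 + b * bs) * (b * par_Z (cj S) x + bs * par_Z S x) / (2 * (1 - b * bs)^2)
          + (a * (2 * a * b - bs * par_W_conj S x) + as * (2 * as * bs - b * par_W (cj S) x))
            / (2 * (1 + b * bs))"
    by (simp add: D_conj_cj[OF df(4)] par_cj[OF dS(1)] par_cj[OF dS(2)] c_def a'_def TW_def SZ_def SV_def)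
qed

text \<open>The parameters are compared in the order b, a, c. Equality of b and of a is shown on all
  of U, since the formulas for a and c contain their derivatives.\<close>

lemma weyl_tetrad_unique:
  assumes pde: "integrable_pde_pair U S"
    and p: "tetrad_params U p" "torsion_free_weyl_connection U S p \<omega> A"
    and p': "tetrad_params U p'" "torsion_free_weyl_connection U S p' \<omega>' A'"
    and x: "x \<in> U"
  shows "b_of p' x = b_of p x" "(alpha_of p' x)^2 = (alpha_of p x)^2"
    "a_of p' x = a_of p x" "c_of p' x = c_of p x"
proof -
  have U: "open U" using pde unfolding integrable_pde_pair_def by blast
  have b: "b_of p' y = b_of p y" if "y \<in> U" for y
    using weyl_b_alpha(1)[OF pde p that] weyl_b_alpha(1)[OF pde p' that] by simp
  then show bx: "b_of p' x = b_of p x" using x .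
  have "complex_of_real (alpha_of p' x)^2 = complex_of_real (alpha_of p x)^2"
    using weyl_b_alpha(2,3)[OF pde p x] weyl_b_alpha(2)[OF pde p' x] unfolding bx
    by (metis mult_right_cancel power_not_zero)
  then show "(alpha_of p' x)^2 = (alpha_of p x)^2"
    by (metis of_real_eq_iff of_real_power)
  have a: "a_of p' y = a_of p y" if y: "y \<in> U" for y
  proof -
    have Db: "D S (b_of p') y = D S (b_of p) y" "D S (cj (b_of p')) y = D S (cj (b_of p)) y"
      by (rule D_cong[OF U y], simp add: b cj_def)+
    have Dcb: "D_conj S (cj (b_of p')) y = D_conj S (cj (b_of p)) y"
      unfolding D_conj_cj[OF tetrad_differentiable(3)[OF p(1) y]]
        D_conj_cj[OF tetrad_differentiable(3)[OF p'(1) y]] Db ..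
    show ?thesis
    proof (cases "b_of p y = 0")
      case True
      then show ?thesis
        using weyl_tetrad_parameters(1)[OF pde p y] weyl_tetrad_parameters(1)[OF pde p' y] b[OF y] Db
        by simp
    next
      case False
      then show ?thesis
        using weyl_tetrad_parameters(2)[OF pde p y] weyl_tetrad_parameters(2)[OF pde p' y]
        unfolding cj_def[of _ y] Db Dcb b[OF y] by metis
    qed
  qed
  then show ax: "a_of p' x = a_of p x" using x .
  have Da: "D S (a_of p') x = D S (a_of p) x"
    by (rule D_cong[OF U x a])
  have Dca: "D_conj S (cj (a_of p')) x = D_conj S (cj (a_of p)) x"
    unfolding D_conj_cj[OF tetrad_differentiable(4)[OF p(1) x]]
      D_conj_cj[OF tetrad_differentiable(4)[OF p'(1) x]] Da ..
  have "complex_of_real (c_of p' x) = complex_of_real (c_of p x)"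
    unfolding weyl_tetrad_parameters(3)[OF pde p x] weyl_tetrad_parameters(3)[OF pde p' x]
    unfolding cj_def[of _ x] Da Dca bx ax ..
  then show "c_of p' x = c_of p x" by simp
qed

theorem theorem2:
  fixes U :: "jet set" and S :: "jet \<Rightarrow> complex" and p :: tetrad_data
    and \<Delta> :: components
    and \<omega> :: "idx \<Rightarrow> idx \<Rightarrow> full_idx \<Rightarrow> jet \<Rightarrow> complex"
    and A :: "full_idx \<Rightarrow> jet \<Rightarrow> complex"
  assumes pde: "integrable_pde_pair U S"
    and tetrad: "tetrad_params U p"
    and struct: "structure_functions U S p \<Delta>"
    and weyl: "torsion_free_weyl_connection U S p \<omega> A"
  shows
    "(\<forall>x\<in>U. \<forall>i j.
        \<omega> i j Is x = lowered \<Delta> i (L j) Is x \<and>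
        \<omega> i j Is_conj x = lowered \<Delta> i (L j) Is_conj x \<and>
        (\<forall>k. \<omega> i j (L k) x =
           eta i j * A (L k) x - eta j k * A (L i) x + eta k i * A (L j) x
           + 1 / 2 * (lowered \<Delta> i (L j) (L k) x - lowered \<Delta> k (L i) (L j) x
                      + lowered \<Delta> j (L k) (L i) x)))
     \<and>
     (\<forall>p' \<omega>' A'. tetrad_params U p' \<and> torsion_free_weyl_connection U S p' \<omega>' A' \<longrightarrow>
        (\<forall>x\<in>U. b_of p' x = b_of p x \<and> (alpha_of p' x)^2 = (alpha_of p x)^2 \<and>
               a_of p' x = a_of p x \<and> c_of p' x = c_of p x))
     \<and>
     (\<forall>x\<in>U. let fb = b_of p; fa = a_of p; Ss = cj S; Ts = cj (T S);
                b = fb x; bs = cj fb x; a = fa x; as = cj fa x in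
        b = b_root S x \<and>
        complex_of_real ((alpha_of p x)^2) = (1 + b * bs) / (1 - b * bs)^2 \<and>
        (b \<noteq> 0 \<longrightarrow>
          a = inverse b * inverse bs * inverse ((1 - b * bs)^2) * (1 + b * bs) *
              (bs^2 * (- D S fb x + b * par_W S x - par_W_conj S x)
               + b * (- D_conj S (cj fb) x + bs * par_W_conj Ss x - par_W Ss x))) \<and>
        complex_of_real (c_of p x) =
          - (D S fa x + D_conj S (cj fa) x + par_W (T S) x + par_W_conj Ts x) / 4
          - a * as * (1 + 6 * b * bs + b^2 * bs^2) / (2 * (1 + b * bs)^2)
          + (1 + b * bs) * (b * par_Z Ss x + bs * par_Z S x) / (2 * (1 - b * bs)^2)
          + (a * (2 * a * b - bs * par_W_conj S x) + as * (2 * as * bs - b * par_W Ss x))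
            / (2 * (1 + b * bs)))
     \<and>
     (\<forall>x\<in>U. wuenschmann S x = 0 \<and> cnj (wuenschmann S x) = 0)"
proof (intro conjI)
  show "\<forall>x\<in>U. \<forall>i j.
        \<omega> i j Is x = lowered \<Delta> i (L j) Is x \<and>
        \<omega> i j Is_conj x = lowered \<Delta> i (L j) Is_conj x \<and>
        (\<forall>k. \<omega> i j (L k) x =
           eta i j * A (L k) x - eta j k * A (L i) x + eta k i * A (L j) x
           + 1 / 2 * (lowered \<Delta> i (L j) (L k) x - lowered \<Delta> k (L i) (L j) x
                      + lowered \<Delta> j (L k) (L i) x))"
    using weyl_connection_components[OF tetrad weyl struct] by blast
next
  show "\<forall>p' \<omega>' A'. tetrad_params U p' \<and> torsion_free_weyl_connection U S p' \<omega>' A' \<longrightarrow>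
        (\<forall>x\<in>U. b_of p' x = b_of p x \<and> (alpha_of p' x)^2 = (alpha_of p x)^2 \<and>
               a_of p' x = a_of p x \<and> c_of p' x = c_of p x)"
    using weyl_tetrad_unique[OF pde tetrad weyl] by blast
next
  show "\<forall>x\<in>U. let fb = b_of p; fa = a_of p; Ss = cj S; Ts = cj (T S);
                b = fb x; bs = cj fb x; a = fa x; as = cj fa x in
        b = b_root S x \<and>
        complex_of_real ((alpha_of p x)^2) = (1 + b * bs) / (1 - b * bs)^2 \<and>
        (b \<noteq> 0 \<longrightarrow>
          a = inverse b * inverse bs * inverse ((1 - b * bs)^2) * (1 + b * bs) *
              (bs^2 * (- D S fb x + b * par_W S x - par_W_conj S x)
               + b * (- D_conj S (cj fb) x + bs * par_W_conj Ss x - par_W Ss x))) \<and>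
        complex_of_real (c_of p x) =
          - (D S fa x + D_conj S (cj fa) x + par_W (T S) x + par_W_conj Ts x) / 4
          - a * as * (1 + 6 * b * bs + b^2 * bs^2) / (2 * (1 + b * bs)^2)
          + (1 + b * bs) * (b * par_Z Ss x + bs * par_Z S x) / (2 * (1 - b * bs)^2)
          + (a * (2 * a * b - bs * par_W_conj S x) + as * (2 * as * bs - b * par_W Ss x))
            / (2 * (1 + b * bs))"
    unfolding Let_def
  proof (intro ballI conjI impI)
    fix x assume x: "x \<in> U"
    note ba = weyl_b_alpha[OF pde tetrad weyl x]
    show "b_of p x = b_root S x" using ba(1) ..
    show "complex_of_real ((alpha_of p x)^2)
        = (1 + b_of p x * cj (b_of p) x) / (1 - b_of p x * cj (b_of p) x)^2"
      using ba(2,3) by (simp add: cj_def field_simps)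
  qed (use weyl_tetrad_parameters(2,3)[OF pde tetrad weyl] in blast)+
next
  show "\<forall>x\<in>U. wuenschmann S x = 0 \<and> cnj (wuenschmann S x) = 0"
    using weyl_tetrad_parameters(4)[OF pde tetrad weyl] by simp
qed

end
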